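(* Let $T$ be a partial semigroup satisfying $\mathcal D\mathsf{max}(T)$, with maximum $\mathscr J$-class $D_T$, and let $S$ be the ideal $T\setminus D_T$ (assumed non-empty). Let $G$ be a group $\mathscr H^T$-class contained in $D_T$, and for each normal subgroup $N\unlhd G$ let $\tau_N=(\nu_N)^\sharp_T{\restriction}_S$, the restriction to $S$ of the congruence on $T$ generated by $\nu_N$. Let $\operatorname{Cong}^T(S)$ be the set of all congruences on $S$ that are liftable to $T$. (i) The interval $[\Delta_T,R^T_{S,G}]$ in the lattice $\operatorname{Cong}(T)$ is $$[\Delta_T,R^T_{S,G}]=\{\sigma\cup\nu_N:\ \sigma\in\operatorname{Cong}^T(S),\ N\unlhd G,\ \tau_N\subseteq\sigma\}.$$ (ii) If $\nabla\mathsf{gen}(T)$ holds, then $$\operatorname{Cong}(T)=\{\sigma\cup\nu_N:\ \sigma\in\operatorname{Cong}^T(S),\ N\unlhd G,\ \tau_N\subseteq\sigma\}\cup\{\widetilde\nabla_T\}.$$ (iii) If $\mathsf{Sep}(T)$ and $\nabla\mathsf{gen}(S)$ hold, then $$\operatorname{Cong}(T)=\{\sigma\cup\Delta_{D_T}:\ \sigma\in\operatorname{Cong}^T(S)\}\cup\{R^T_{S,N}:\ N\unlhd G\}\cup\{\widetilde\nabla_T\}.$$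
   Context: **Partial semigroups.** A partial semigroup is a 5-tuple $(S,\mathscr C,\mathbf d,\mathbf r,\cdot)$ where $S$ (morphisms) and $\mathscr C$ (objects) are sets, $\mathbf d,\mathbf r:S\to\mathscr C$ are maps, and $\cdot$ is a partial binary operation on $S$ such that $xy$ is defined iff $\mathbf r(x)=\mathbf d(y)$, in which case $\mathbf d(xy)=\mathbf d(x)$ and $\mathbf r(xy)=\mathbf r(y)$, and $(xy)z=x(yz)$ whenever $xy$ and $yz$ are defined. $S^1$ is the category obtained from $S$ by adjoining identities at objects where needed. Write $x\sim y$ if $\mathbf d(x)=\mathbf d(y)$ and $\mathbf r(x)=\mathbf r(y)$. An ideal is a non-empty subset $I\subseteq S$ containing all defined products $sx$, $xs$ with $x\in I$, $s\in S$; it is itself a partial semigroup. An element $x$ is regular if $x=xax$ for some $a\in S$. Green's relations: $x\mathrel{\mathscr R}y\Leftrightarrow xS^1=yS^1$, $x\mathrel{\mathscr L}y\Leftrightarrow S^1x=S^1y$, $x\mathrel{\mathscr J}y\Leftrightarrow S^1xS^1=S^1yS^1$, $\mathscr H=\mathscr R\cap\mathscr L$, $\mathscr D=\mathscr R\vee\mathscr L$; $\mathscr J$-classes are ordered by $J_x\le J_y\Leftrightarrow x\in S^1yS^1$. $H_x^S$ is the $\mathscr H$-class of $x$ in $S$. A $\mathscr J$-class $J$ is stable if for all $x\in J$, $a\in S$: $(x,xa)\in\mathscr J\Rightarrow(x,xa)\in\mathscr R$ and $(x,ax)\in\mathscr J\Rightarrow(x,ax)\in\mathscr L$ (when the products are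 defined). **Congruences.** A congruence on $S$ is an equivalence $\sigma$ such that $(x,y)\in\sigma$ implies $x\sim y$, and $(ax,ay)\in\sigma$ whenever $\mathbf r(a)=\mathbf d(x)$, and $(xa,ya)\in\sigma$ whenever $\mathbf d(a)=\mathbf r(x)$. $\operatorname{Cong}(S)$ is the lattice of congruences ordered by inclusion. $\Omega^\sharp_S$ (or $(x,y)^\sharp_S$ for $\Omega=\{(x,y)\}$) is the congruence on $S$ generated by $\Omega$. $\Delta_X$ is the equality relation on $X$; $\widetilde\nabla_S=\{(x,y)\in S\times S:x\sim y\}$ is the largest congruence. For an ideal $I$, $R_I^S=\widetilde\nabla_I\cup\Delta_S$. If $N$ is a normal subgroup of a group $\mathscr H$-class contained in a stable regular $\mathscr J$-class $D$ of $S$, then $\nu_N=\{(axb,ayb): x,y\in N,\ a,b\in S^1,\ axb,ayb\in D\}$; if moreover $D$ is minimal among the $\mathscr J$-classes contained in $S\setminus I$, then $R^S_{I,N}=R_I^S\cup\nu_N$ (a congruence). If $T$ has an ideal $S$, a congruence $\sigma$ on $S$ is liftable to $T$ if $\sigma\cup\Delta_T$ is a congruence on $T$. **Properties.** $\mathcal D\mathsf{max}(T)$: $T$ has a maximum $\mathscr J$-class, and it is regular and stable; it is denoted $D_T$. $\nabla\mathsf{gen}(T)$: $\mathcal D\mathsf{max}(T)$ holds and for any $x\in D_T$ and $y\in T\setminus H_x^T$ with $x\sim y$ we have $(x,y)^\sharp_T=\widetilde\nabla_T$. $\mathsf{Sep}(T)$: $\mathcal D\mathsf{max}(T)$ holds,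 the ideal $S=T\setminus D_T$ satisfies $\mathcal D\mathsf{max}(S)$, and: (S1) for $x\in D_T$, $y\in S$ with $x\sim y$ there is $(x',y')\in(x,y)^\sharp_T$ with $x'\in D_S$, $y'\in S\setminus H^S_{x'}$; (S2) for $x\in D_T$, $y\in D_T\setminus H_x^T$ with $x\sim y$ there is $(x',y')\in(x,y)^\sharp_T$ with $x'\in D_T$, $y'\in S$; (S3) for $x\in D_T$, $y\in H_x^T\setminus\{x\}$ there is $(x',y')\in(x,y)^\sharp_T$ with $x'\in D_S$, $y'\in S\setminus H^S_{x'}$. *)

theory Defs
  imports "HOL-Algebra.Coset"
begin

section \<open>Partial semigroups\<close>

text \<open>
  The partial operation is represented, in the style of HOL-Algebra, by a total function
  \<open>pcomp\<close> whose values are meaningful only at composable pairs of morphisms; the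
  definitions below must not depend on its values elsewhere.
\<close>

record ('a, 'o) psg = "'a partial_object" +
  Objs :: "'o set"
  pdom :: "'a \<Rightarrow> 'o"
  pran :: "'a \<Rightarrow> 'o"
  pcomp :: "'a \<Rightarrow> 'a \<Rightarrow> 'a"

definition composable :: "('a, 'o) psg \<Rightarrow> 'a \<Rightarrow> 'a \<Rightarrow> bool" where
  "composable P x y \<longleftrightarrow> x \<in> carrier P \<and> y \<in> carrier P \<and> pran P x = pdom P y"

definition partial_semigroup :: "('a, 'o) psg \<Rightarrow> bool" where
  "partial_semigroup P \<longleftrightarrow>
     pdom P \<in> carrier P \<rightarrow> Objs P \<and>
     pran P \<in> carrier P \<rightarrow> Objs P \<and>
     (\<forall>x y. composable P x y \<longrightarrow>
        pcomp P x y \<in> carrier P \<and>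
        pdom P (pcomp P x y) = pdom P x \<and>
        pran P (pcomp P x y) = pran P y) \<and>
     (\<forall>x y z. composable P x y \<longrightarrow> composable P y z \<longrightarrow>
        pcomp P (pcomp P x y) z = pcomp P x (pcomp P y z))"

definition psg_restrict :: "('a, 'o) psg \<Rightarrow> 'a set \<Rightarrow> ('a, 'o) psg" where
  "psg_restrict P I = P\<lparr>carrier := I\<rparr>"

definition parallel :: "('a, 'o) psg \<Rightarrow> 'a \<Rightarrow> 'a \<Rightarrow> bool" where
  "parallel P x y \<longleftrightarrow> pdom P x = pdom P y \<and> pran P x = pran P y"

section \<open>Adjoining identities\<close>

definition is_identity_at :: "('a, 'o) psg \<Rightarrow> 'o \<Rightarrow> 'a \<Rightarrow> bool" where
  "is_identity_at P c e \<longleftrightarrow>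
     e \<in> carrier P \<and> pdom P e = c \<and> pran P e = c \<and>
     (\<forall>x. composable P e x \<longrightarrow> pcomp P e x = x) \<and>
     (\<forall>x. composable P x e \<longrightarrow> pcomp P x e = x)"

text \<open>
  The category \<open>P\<^sup>1\<close>: \<open>Inl x\<close> is the morphism \<open>x\<close> of \<open>P\<close>, and \<open>Inr c\<close> is the identity
  adjoined at an object \<open>c\<close> at which \<open>P\<close> has no identity.
\<close>

definition adjoin_ids :: "('a, 'o) psg \<Rightarrow> ('a + 'o, 'o) psg" where
  "adjoin_ids P =
     \<lparr>carrier = Inl ` carrier P \<union> Inr ` {c \<in> Objs P. \<nexists>e. is_identity_at P c e},
      Objs = Objs P,
      pdom = case_sum (pdom P) id,
      pran = case_sum (pran P) id,
      pcomp = (\<lambda>u v. case u of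
                 Inr c \<Rightarrow> v
               | Inl x \<Rightarrow> (case v of Inr c \<Rightarrow> u | Inl y \<Rightarrow> Inl (pcomp P x y)))\<rparr>"

text \<open>
  \<open>sandwich P a x b u\<close> says that \<open>a x b\<close> is defined in \<open>P\<^sup>1\<close> and equals \<open>u\<close>,
  where \<open>a, b \<in> P\<^sup>1\<close> and \<open>x \<in> P\<close>.  The result always lies in \<open>P\<close>, as \<open>P\<close> is an ideal
  of \<open>P\<^sup>1\<close>; accordingly \<open>xP\<^sup>1\<close>, \<open>P\<^sup>1x\<close> and \<open>P\<^sup>1xP\<^sup>1\<close> are taken as subsets of \<open>P\<close>.
\<close>

definition sandwich :: "('a, 'o) psg \<Rightarrow> 'a + 'o \<Rightarrow> 'a \<Rightarrow> 'a + 'o \<Rightarrow> 'a \<Rightarrow> bool" where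
  "sandwich P a x b u \<longleftrightarrow>
     composable (adjoin_ids P) a (Inl x) \<and> composable (adjoin_ids P) (Inl x) b \<and>
     Inl u = pcomp (adjoin_ids P) (pcomp (adjoin_ids P) a (Inl x)) b"

definition right_principal :: "('a, 'o) psg \<Rightarrow> 'a \<Rightarrow> 'a set" where
  "right_principal P x =
     {u. \<exists>s. composable (adjoin_ids P) (Inl x) s \<and> Inl u = pcomp (adjoin_ids P) (Inl x) s}"

definition left_principal :: "('a, 'o) psg \<Rightarrow> 'a \<Rightarrow> 'a set" where
  "left_principal P x =
     {u. \<exists>s. composable (adjoin_ids P) s (Inl x) \<and> Inl u = pcomp (adjoin_ids P) s (Inl x)}"

definition two_sided_principal :: "('a, 'o) psg \<Rightarrow> 'a \<Rightarrow> 'a set" where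
  "two_sided_principal P x = {u. \<exists>a b. sandwich P a x b u}"

section \<open>Green's relations\<close>

definition green_R :: "('a, 'o) psg \<Rightarrow> 'a rel" where
  "green_R P = {(x, y) \<in> carrier P \<times> carrier P. right_principal P x = right_principal P y}"

definition green_L :: "('a, 'o) psg \<Rightarrow> 'a rel" where
  "green_L P = {(x, y) \<in> carrier P \<times> carrier P. left_principal P x = left_principal P y}"

definition green_J :: "('a, 'o) psg \<Rightarrow> 'a rel" where
  "green_J P =
     {(x, y) \<in> carrier P \<times> carrier P. two_sided_principal P x = two_sided_principal P y}"

definition green_H :: "('a, 'o) psg \<Rightarrow> 'a rel" where
  "green_H P = green_R P \<inter> green_L P"

abbreviation H_class :: "('a, 'o) psg \<Rightarrow> 'a \<Rightarrow> 'a set" where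
  "H_class P x \<equiv> green_H P `` {x}"

abbreviation J_class :: "('a, 'o) psg \<Rightarrow> 'a \<Rightarrow> 'a set" where
  "J_class P x \<equiv> green_J P `` {x}"

definition J_le :: "('a, 'o) psg \<Rightarrow> 'a set \<Rightarrow> 'a set \<Rightarrow> bool" where
  "J_le P A B \<longleftrightarrow>
     (\<exists>x\<in>carrier P. \<exists>y\<in>carrier P.
        A = J_class P x \<and> B = J_class P y \<and> x \<in> two_sided_principal P y)"

definition is_max_J_class :: "('a, 'o) psg \<Rightarrow> 'a set \<Rightarrow> bool" where
  "is_max_J_class P M \<longleftrightarrow>
     M \<in> carrier P // green_J P \<and> (\<forall>K \<in> carrier P // green_J P. J_le P K M)"

definition max_J_class :: "('a, 'o) psg \<Rightarrow> 'a set" where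
  "max_J_class P = (THE M. is_max_J_class P M)"

definition regular_elem :: "('a, 'o) psg \<Rightarrow> 'a \<Rightarrow> bool" where
  "regular_elem P x \<longleftrightarrow>
     (\<exists>a. composable P x a \<and> composable P a x \<and> x = pcomp P (pcomp P x a) x)"

definition stable_J_class :: "('a, 'o) psg \<Rightarrow> 'a set \<Rightarrow> bool" where
  "stable_J_class P J \<longleftrightarrow>
     (\<forall>x\<in>J. \<forall>a\<in>carrier P.
        (composable P x a \<and> (x, pcomp P x a) \<in> green_J P \<longrightarrow> (x, pcomp P x a) \<in> green_R P) \<and>
        (composable P a x \<and> (x, pcomp P a x) \<in> green_J P \<longrightarrow> (x, pcomp P a x) \<in> green_L P))"

text \<open>
  The composability condition in \<open>group_H_class\<close> is needed because \<open>pcomp\<close> is total: without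
  it, junk values of \<open>pcomp\<close> could make a non-composable \<open>\<H>\<close>-class look like a group.
\<close>

definition H_group :: "('a, 'o) psg \<Rightarrow> 'a set \<Rightarrow> 'a monoid" where
  "H_group P H =
     \<lparr>carrier = H, monoid.mult = pcomp P,
      one = (THE e. e \<in> H \<and> (\<forall>x\<in>H. pcomp P e x = x \<and> pcomp P x e = x))\<rparr>"

definition group_H_class :: "('a, 'o) psg \<Rightarrow> 'a set \<Rightarrow> bool" where
  "group_H_class P H \<longleftrightarrow>
     H \<in> carrier P // green_H P \<and>
     (\<forall>x\<in>H. \<forall>y\<in>H. composable P x y) \<and>
     group (H_group P H)"

section \<open>Congruences\<close>

definition congruence :: "('a, 'o) psg \<Rightarrow> 'a rel \<Rightarrow> bool" where
  "congruence P \<sigma> \<longleftrightarrow>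
     equiv (carrier P) \<sigma> \<and>
     (\<forall>(x, y) \<in> \<sigma>. parallel P x y) \<and>
     (\<forall>(x, y) \<in> \<sigma>. \<forall>a. composable P a x \<longrightarrow> (pcomp P a x, pcomp P a y) \<in> \<sigma>) \<and>
     (\<forall>(x, y) \<in> \<sigma>. \<forall>a. composable P x a \<longrightarrow> (pcomp P x a, pcomp P y a) \<in> \<sigma>)"

definition Cong :: "('a, 'o) psg \<Rightarrow> 'a rel set" where
  "Cong P = {\<sigma>. congruence P \<sigma>}"

definition nabla :: "('a, 'o) psg \<Rightarrow> 'a rel" where
  "nabla P = {(x, y) \<in> carrier P \<times> carrier P. parallel P x y}"

text \<open>Meaningful for \<open>\<Omega> \<subseteq> nabla P\<close>; otherwise no congruence contains \<open>\<Omega>\<close>.\<close>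

definition cong_gen :: "('a, 'o) psg \<Rightarrow> 'a rel \<Rightarrow> 'a rel" where
  "cong_gen P \<Omega> = \<Inter>{\<sigma> \<in> Cong P. \<Omega> \<subseteq> \<sigma>}"

definition rees :: "('a, 'o) psg \<Rightarrow> 'a set \<Rightarrow> 'a rel" where
  "rees P I = nabla (psg_restrict P I) \<union> Id_on (carrier P)"

text \<open>In \<open>nu P D N\<close>, \<open>D\<close> is the (stable regular) \<open>\<J>\<close>-class of \<open>P\<close> that contains \<open>N\<close>.\<close>

definition nu :: "('a, 'o) psg \<Rightarrow> 'a set \<Rightarrow> 'a set \<Rightarrow> 'a rel" where
  "nu P D N =
     {(u, v) \<in> D \<times> D. \<exists>x\<in>N. \<exists>y\<in>N. \<exists>a b. sandwich P a x b u \<and> sandwich P a y b v}"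

definition rees_normal :: "('a, 'o) psg \<Rightarrow> 'a set \<Rightarrow> 'a set \<Rightarrow> 'a set \<Rightarrow> 'a rel" where
  "rees_normal P I D N = rees P I \<union> nu P D N"

definition Cong_liftable :: "('a, 'o) psg \<Rightarrow> 'a set \<Rightarrow> 'a rel set" where
  "Cong_liftable T I =
     {\<sigma> \<in> Cong (psg_restrict T I). \<sigma> \<union> Id_on (carrier T) \<in> Cong T}"

section \<open>Properties of partial semigroups\<close>

definition Dmax :: "('a, 'o) psg \<Rightarrow> bool" where
  "Dmax T \<longleftrightarrow>
     (\<exists>M. is_max_J_class T M \<and> (\<forall>x\<in>M. regular_elem T x) \<and> stable_J_class T M)"

definition below_max :: "('a, 'o) psg \<Rightarrow> ('a, 'o) psg" where
  "below_max T = psg_restrict T (carrier T - max_J_class T)"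

definition nabla_gen :: "('a, 'o) psg \<Rightarrow> bool" where
  "nabla_gen T \<longleftrightarrow>
     Dmax T \<and>
     (\<forall>x \<in> max_J_class T. \<forall>y \<in> carrier T - H_class T x.
        parallel T x y \<longrightarrow> cong_gen T {(x, y)} = nabla T)"

definition Sep1 :: "('a, 'o) psg \<Rightarrow> bool" where
  "Sep1 T \<longleftrightarrow>
     (let S = below_max T in
      \<forall>x \<in> max_J_class T. \<forall>y \<in> carrier S. parallel T x y \<longrightarrow>
        (\<exists>(x', y') \<in> cong_gen T {(x, y)}.
           x' \<in> max_J_class S \<and> y' \<in> carrier S - H_class S x'))"

definition Sep2 :: "('a, 'o) psg \<Rightarrow> bool" where
  "Sep2 T \<longleftrightarrow>
     (let S = below_max T in
      \<forall>x \<in> max_J_class T. \<forall>y \<in> max_J_class T - H_class T x. parallel T x y \<longrightarrow>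
        (\<exists>(x', y') \<in> cong_gen T {(x, y)}. x' \<in> max_J_class T \<and> y' \<in> carrier S))"

definition Sep3 :: "('a, 'o) psg \<Rightarrow> bool" where
  "Sep3 T \<longleftrightarrow>
     (let S = below_max T in
      \<forall>x \<in> max_J_class T. \<forall>y \<in> H_class T x - {x}.
        (\<exists>(x', y') \<in> cong_gen T {(x, y)}.
           x' \<in> max_J_class S \<and> y' \<in> carrier S - H_class S x'))"

definition Sep :: "('a, 'o) psg \<Rightarrow> bool" where
  "Sep T \<longleftrightarrow> Dmax T \<and> Dmax (below_max T) \<and> Sep1 T \<and> Sep2 T \<and> Sep3 T"

definition tau :: "('a, 'o) psg \<Rightarrow> 'a set \<Rightarrow> 'a rel" where
  "tau T N = Restr (cong_gen T (nu T (max_J_class T) N)) (carrier (below_max T))"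

end

theory Submission
  imports Defs
begin

text \<open>
  Let \<open>e\<close> be the identity of the group \<open>G\<close>.  Since \<open>D\<close> is regular and stable, every element of \<open>D\<close>
  is a product \<open>a b\<close> with \<open>a\<close> in the \<open>\<L>\<close>-class and \<open>b\<close> in the \<open>\<R>\<close>-class of \<open>e\<close>, and \<open>\<nu>\<^sub>N\<close> consists of
  the pairs \<open>(a x b, a y b)\<close> with \<open>x, y \<in> N\<close>.  Two such factorizations of one element differ by elements
  of \<open>G\<close>, so normality of \<open>N\<close> makes \<open>\<nu>\<^sub>N\<close> transitive; products that leave \<open>D\<close> are absorbed by \<open>\<tau>\<^sub>N\<close>.
  Conversely, multiplying \<open>a x b\<close> back to \<open>x\<close> shows that the part of a congruence inside \<open>D\<close> is
  \<open>\<nu>\<^sub>N\<close>, where \<open>N\<close> is the congruence class of \<open>e\<close> in \<open>G\<close>.  Under \<open>\<nabla>gen(T)\<close> any congruence other than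
  \<open>nabla T\<close> relates elements of \<open>D\<close> only within \<open>\<H>\<close>-classes, so it lies below \<open>R\<^sub>S\<^sub>,\<^sub>G\<close>.  Finally \<open>Sep(T)\<close> and
  \<open>\<nabla>gen(S)\<close> imply \<open>\<nabla>gen(T)\<close>, and (S3) forces \<open>\<sigma> = nabla S\<close> as soon as \<open>N \<noteq> {e}\<close>.
\<close>

section \<open>Congruences\<close>

lemma congruence_iff:
  "congruence P \<sigma> \<longleftrightarrow>
     \<sigma> \<subseteq> carrier P \<times> carrier P \<and>
     (\<forall>x \<in> carrier P. (x, x) \<in> \<sigma>) \<and>
     (\<forall>x y. (x, y) \<in> \<sigma> \<longrightarrow> (y, x) \<in> \<sigma>) \<and>
     (\<forall>x y z. (x, y) \<in> \<sigma> \<longrightarrow> (y, z) \<in> \<sigma> \<longrightarrow> (x, z) \<in> \<sigma>) \<and>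
     (\<forall>x y. (x, y) \<in> \<sigma> \<longrightarrow> parallel P x y) \<and>
     (\<forall>x y a. (x, y) \<in> \<sigma> \<longrightarrow> composable P a x \<longrightarrow> (pcomp P a x, pcomp P a y) \<in> \<sigma>) \<and>
     (\<forall>x y a. (x, y) \<in> \<sigma> \<longrightarrow> composable P x a \<longrightarrow> (pcomp P x a, pcomp P y a) \<in> \<sigma>)"
proof -
  have split: "(\<forall>(x, y) \<in> \<sigma>. Q x y) \<longleftrightarrow> (\<forall>x y. (x, y) \<in> \<sigma> \<longrightarrow> Q x y)" for Q
    by blast
  show ?thesis
    unfolding congruence_def equiv_def refl_on_def sym_def trans_def split by simp
qed

lemma congruenceI:
  assumes "\<sigma> \<subseteq> carrier P \<times> carrier P"
    and "\<And>x. x \<in> carrier P \<Longrightarrow> (x, x) \<in> \<sigma>"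
    and "\<And>x y. (x, y) \<in> \<sigma> \<Longrightarrow> (y, x) \<in> \<sigma>"
    and "\<And>x y z. (x, y) \<in> \<sigma> \<Longrightarrow> (y, z) \<in> \<sigma> \<Longrightarrow> (x, z) \<in> \<sigma>"
    and "\<And>x y. (x, y) \<in> \<sigma> \<Longrightarrow> parallel P x y"
    and "\<And>x y a. (x, y) \<in> \<sigma> \<Longrightarrow> composable P a x \<Longrightarrow> (pcomp P a x, pcomp P a y) \<in> \<sigma>"
    and "\<And>x y a. (x, y) \<in> \<sigma> \<Longrightarrow> composable P x a \<Longrightarrow> (pcomp P x a, pcomp P y a) \<in> \<sigma>"
  shows "congruence P \<sigma>"
  unfolding congruence_iff
  by (intro conjI allI ballI impI, rule assms(1), erule assms(2), erule assms(3),
      erule (1) assms(4), erule assms(5), erule (1) assms(6), erule (1) assms(7))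

lemma congruenceD:
  assumes "congruence P \<sigma>"
  shows congruence_subset: "\<sigma> \<subseteq> carrier P \<times> carrier P"
    and congruence_refl: "x \<in> carrier P \<Longrightarrow> (x, x) \<in> \<sigma>"
    and congruence_sym: "(x, y) \<in> \<sigma> \<Longrightarrow> (y, x) \<in> \<sigma>"
    and congruence_trans: "(x, y) \<in> \<sigma> \<Longrightarrow> (y, z) \<in> \<sigma> \<Longrightarrow> (x, z) \<in> \<sigma>"
    and congruence_parallel: "(x, y) \<in> \<sigma> \<Longrightarrow> parallel P x y"
    and congruence_left: "(x, y) \<in> \<sigma> \<Longrightarrow> composable P a x \<Longrightarrow> (pcomp P a x, pcomp P a y) \<in> \<sigma>"
    and congruence_right: "(x, y) \<in> \<sigma> \<Longrightarrow> composable P x a \<Longrightarrow> (pcomp P x a, pcomp P y a) \<in> \<sigma>"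
  by (insert assms, unfold congruence_iff, (elim conjE, metis)+)

lemma cong_gen_least: "congruence P \<sigma> \<Longrightarrow> \<Omega> \<subseteq> \<sigma> \<Longrightarrow> cong_gen P \<Omega> \<subseteq> \<sigma>"
  by (auto simp: cong_gen_def Cong_def)

lemma psg_restrict_simps [simp]:
  "carrier (psg_restrict P I) = I" "pdom (psg_restrict P I) = pdom P"
  "pran (psg_restrict P I) = pran P" "pcomp (psg_restrict P I) = pcomp P"
  "Objs (psg_restrict P I) = Objs P"
  "parallel (psg_restrict P I) = parallel P"
  by (auto simp: psg_restrict_def parallel_def fun_eq_iff)

section \<open>Green's preorders\<close>

locale partial_sg =
  fixes T :: "('a, 'o) psg"
  assumes partial_semigroup: "partial_semigroup T"
begin

abbreviation C where "C \<equiv> carrier T"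
abbreviation dm where "dm \<equiv> pdom T"
abbreviation rn where "rn \<equiv> pran T"
abbreviation comp (infixl "\<cdot>" 70) where "x \<cdot> y \<equiv> pcomp T x y"

lemma comp_simps [simp]:
  assumes "x \<in> C" "y \<in> C" "rn x = dm y"
  shows "x \<cdot> y \<in> C" "dm (x \<cdot> y) = dm x" "rn (x \<cdot> y) = rn y"
  using partial_semigroup assms by (auto simp: partial_semigroup_def composable_def)

text \<open>Products are normalised by bracketing to the right; cancelling a pair that stands on the
  left therefore takes explicit instances of this law.\<close>

lemma assoc [simp]:
  assumes "x \<in> C" "y \<in> C" "z \<in> C" "rn x = dm y" "rn y = dm z"
  shows "x \<cdot> y \<cdot> z = x \<cdot> (y \<cdot> z)"
  using partial_semigroup assms by (auto simp: partial_semigroup_def composable_def)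

text \<open>Each of \<open>a\<close> and \<open>b\<close> is an element of \<open>T\<close>, where
  compatibility applies, or an adjoined identity, which leaves the pair unchanged.\<close>

lemma congruence_sandwich:
  assumes \<sigma>: "congruence T \<sigma>" and xy: "(x, y) \<in> \<sigma>"
    and u: "sandwich T a x b u" and v: "sandwich T a y b v"
  shows "(u, v) \<in> \<sigma>"
proof -
  have *: "x \<in> C" "y \<in> C" "dm x = dm y" "rn x = rn y"
    using congruence_subset[OF \<sigma>] congruence_parallel[OF \<sigma> xy] xy
    by (auto simp: parallel_def)
  have l: "(s \<cdot> x, s \<cdot> y) \<in> \<sigma>" if "s \<in> C" "rn s = dm x" for s
    using congruence_left[OF \<sigma> xy] that * by (simp add: composable_def)
  have r: "(p \<cdot> s, q \<cdot> s) \<in> \<sigma>" if "(p, q) \<in> \<sigma>" "p \<in> C" "s \<in> C" "rn p = dm s" for p q s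
    using congruence_right[OF \<sigma>] that by (simp add: composable_def)
  show ?thesis
    using u v * xy l unfolding sandwich_def composable_def adjoin_ids_def
    by (cases a; cases b) (auto intro: r simp del: assoc)
qed

text \<open>The disjunct \<open>u = x\<close> stands for an adjoined identity. One is adjoined at
  \<open>rn x\<close> only when \<open>T\<close> has none there; otherwise the existing identity
  \<open>e\<close> gives \<open>x = x \<cdot> e\<close>, already a product.\<close>

lemma right_principal_iff:
  assumes "x \<in> C"
  shows "u \<in> right_principal T x \<longleftrightarrow> u = x \<or> (\<exists>s\<in>C. rn x = dm s \<and> u = x \<cdot> s)"
proof
  assume "u \<in> right_principal T x"
  thus "u = x \<or> (\<exists>s\<in>C. rn x = dm s \<and> u = x \<cdot> s)"
    by (auto simp: right_principal_def composable_def adjoin_ids_def)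
next
  assume R: "u = x \<or> (\<exists>s\<in>C. rn x = dm s \<and> u = x \<cdot> s)"
  have O: "rn x \<in> Objs T" using partial_semigroup assms by (auto simp: partial_semigroup_def)
  show "u \<in> right_principal T x"
  proof (cases "\<exists>s\<in>C. rn x = dm s \<and> u = x \<cdot> s")
    case True
    then obtain s where "s \<in> C" "rn x = dm s" "u = x \<cdot> s" by blast
    with assms show ?thesis unfolding right_principal_def
      by (auto simp: composable_def adjoin_ids_def intro!: exI[of _ "Inl s"])
  next
    case False
    with R have "u = x" by blast
    show ?thesis
    proof (cases "\<exists>e. is_identity_at T (rn x) e")
      case True
      then obtain e where "is_identity_at T (rn x) e" by blast
      with assms False \<open>u = x\<close> show ?thesis
        by (metis composable_def is_identity_at_def)
    next
      case False
      with assms O \<open>u = x\<close> show ?thesis unfolding right_principal_def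
        by (auto simp: composable_def adjoin_ids_def intro!: exI[of _ "Inr (rn x)"])
    qed
  qed
qed

lemma left_principal_iff:
  assumes "x \<in> C"
  shows "u \<in> left_principal T x \<longleftrightarrow> u = x \<or> (\<exists>s\<in>C. rn s = dm x \<and> u = s \<cdot> x)"
proof
  assume "u \<in> left_principal T x"
  thus "u = x \<or> (\<exists>s\<in>C. rn s = dm x \<and> u = s \<cdot> x)"
    by (auto simp: left_principal_def composable_def adjoin_ids_def)
next
  assume R: "u = x \<or> (\<exists>s\<in>C. rn s = dm x \<and> u = s \<cdot> x)"
  have O: "dm x \<in> Objs T" using partial_semigroup assms by (auto simp: partial_semigroup_def)
  show "u \<in> left_principal T x"
  proof (cases "\<exists>s\<in>C. rn s = dm x \<and> u = s \<cdot> x")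
    case True
    then obtain s where "s \<in> C" "rn s = dm x" "u = s \<cdot> x" by blast
    with assms show ?thesis unfolding left_principal_def
      by (auto simp: composable_def adjoin_ids_def intro!: exI[of _ "Inl s"])
  next
    case False
    with R have "u = x" by blast
    show ?thesis
    proof (cases "\<exists>e. is_identity_at T (dm x) e")
      case True
      then obtain e where "is_identity_at T (dm x) e" by blast
      with assms False \<open>u = x\<close> show ?thesis
        by (metis composable_def is_identity_at_def)
    next
      case False
      with assms O \<open>u = x\<close> show ?thesis unfolding left_principal_def
        by (auto simp: composable_def adjoin_ids_def intro!: exI[of _ "Inr (dm x)"])
    qed
  qed
qed

text \<open>Multiplying on the left first gives an element \<open>v\<close> of \<open>T\<close>, and
  the right multiplier then acts on \<open>v\<close>. This reduces two-sided divisibility to the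
  one-sided cases.\<close>

lemma two_sided_principal_conv:
  assumes "x \<in> C"
  shows "u \<in> two_sided_principal T x \<longleftrightarrow> (\<exists>v \<in> left_principal T x. u \<in> right_principal T v)"
proof
  assume "u \<in> two_sided_principal T x"
  then obtain a b where ab: "sandwich T a x b u" by (auto simp: two_sided_principal_def)
  define v where "v = (case a of Inl s \<Rightarrow> s \<cdot> x | Inr c \<Rightarrow> x)"
  have v: "pcomp (adjoin_ids T) a (Inl x) = Inl v" by (simp add: v_def adjoin_ids_def split: sum.split)
  have "v \<in> left_principal T x"
    using ab v by (auto simp: left_principal_def sandwich_def)
  moreover have "v \<in> C" "rn v = rn x"
    using ab assms by (auto simp: v_def sandwich_def composable_def adjoin_ids_def split: sum.splits)
  with ab v assms have "u \<in> right_principal T v"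
    unfolding right_principal_def sandwich_def
    by (auto intro!: exI[of _ b] simp: composable_def adjoin_ids_def)
  ultimately show "\<exists>v \<in> left_principal T x. u \<in> right_principal T v" by blast
next
  assume "\<exists>v \<in> left_principal T x. u \<in> right_principal T v"
  then obtain v a b where ab: "composable (adjoin_ids T) a (Inl x)"
      "Inl v = pcomp (adjoin_ids T) a (Inl x)" "composable (adjoin_ids T) (Inl v) b"
      "Inl u = pcomp (adjoin_ids T) (Inl v) b"
    by (auto simp: left_principal_def right_principal_def)
  have "rn v = rn x"
    using ab(1,2) assms by (auto simp: composable_def adjoin_ids_def split: sum.splits)
  hence "sandwich T a x b u"
    using ab assms by (auto simp: sandwich_def composable_def adjoin_ids_def)
  thus "u \<in> two_sided_principal T x" by (auto simp: two_sided_principal_def)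
qed

lemma two_sided_principal_iff:
  assumes "x \<in> C"
  shows "u \<in> two_sided_principal T x \<longleftrightarrow>
    u = x \<or> (\<exists>s\<in>C. rn x = dm s \<and> u = x \<cdot> s) \<or> (\<exists>t\<in>C. rn t = dm x \<and> u = t \<cdot> x) \<or>
    (\<exists>t\<in>C. \<exists>s\<in>C. rn t = dm x \<and> rn x = dm s \<and> u = t \<cdot> x \<cdot> s)" (is "_ \<longleftrightarrow> ?R")
proof -
  have "(\<exists>v \<in> left_principal T x. u \<in> right_principal T v) \<longleftrightarrow>
    u \<in> right_principal T x \<or> (\<exists>s\<in>C. rn s = dm x \<and> u \<in> right_principal T (s \<cdot> x))"
    unfolding Bex_def left_principal_iff[OF assms] by blast
  also have "\<dots> \<longleftrightarrow> ?R"
    using assms by (simp add: right_principal_iff cong: conj_cong bex_cong) blast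
  finally show ?thesis using two_sided_principal_conv[OF assms] by simp
qed

section \<open>Divisibility and Green's relations\<close>

lemma two_sided_subset: "x \<in> C \<Longrightarrow> two_sided_principal T x \<subseteq> C"
  by (auto simp: two_sided_principal_iff)

text \<open>The principal ideal of \<open>z\<close> is closed under multiplication on either side
  (\<open>r\<close> and \<open>l\<close>), and \<open>x\<close> arises from its element
  \<open>y\<close> by at most one multiplication on each side.\<close>

lemma two_sided_trans:
  assumes "x \<in> two_sided_principal T y" "y \<in> two_sided_principal T z" "z \<in> C"
  shows "x \<in> two_sided_principal T z"
proof -
  have y: "y \<in> C" using assms two_sided_subset by blast
  have r: "u \<cdot> s \<in> two_sided_principal T z"
    if "u \<in> two_sided_principal T z" "s \<in> C" "rn u = dm s" for u s
    using that \<open>z \<in> C\<close> unfolding two_sided_principal_iff[OF \<open>z \<in> C\<close>]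
    by (elim disjE bexE conjE) (simp_all, (metis comp_simps assoc)+)
  have l: "t \<cdot> u \<in> two_sided_principal T z"
    if "u \<in> two_sided_principal T z" "t \<in> C" "rn t = dm u" for u t
    using that \<open>z \<in> C\<close> unfolding two_sided_principal_iff[OF \<open>z \<in> C\<close>]
    by (elim disjE bexE conjE) (simp_all, (metis comp_simps assoc)+)
  show ?thesis
    using assms(1,2) y unfolding two_sided_principal_iff[OF y]
    by (elim disjE bexE conjE) (auto intro: l r simp del: assoc)
qed

lemma two_sided_refl: "x \<in> C \<Longrightarrow> x \<in> two_sided_principal T x"
  by (simp add: two_sided_principal_iff)

lemma green_J_iff:
  "(x, y) \<in> green_J T \<longleftrightarrow> x \<in> C \<and> y \<in> C \<and> x \<in> two_sided_principal T y \<and> y \<in> two_sided_principal T x"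
proof -
  have "two_sided_principal T x = two_sided_principal T y \<longleftrightarrow>
    x \<in> two_sided_principal T y \<and> y \<in> two_sided_principal T x" if "x \<in> C" "y \<in> C"
    using that two_sided_refl two_sided_trans by blast
  thus ?thesis unfolding green_J_def by blast
qed

lemma right_trans:
  assumes "x \<in> right_principal T y" "y \<in> right_principal T z" "z \<in> C"
  shows "x \<in> right_principal T z"
proof -
  have "y \<in> C" using assms(2,3) by (auto simp: right_principal_iff)
  with assms show ?thesis by (auto simp: right_principal_iff) (metis comp_simps assoc)
qed

lemma left_trans:
  assumes "x \<in> left_principal T y" "y \<in> left_principal T z" "z \<in> C"
  shows "x \<in> left_principal T z"
proof -
  have "y \<in> C" using assms(2,3) by (auto simp: left_principal_iff)
  with assms show ?thesis by (auto simp: left_principal_iff) (metis comp_simps assoc)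
qed

lemma green_R_iff:
  "(x, y) \<in> green_R T \<longleftrightarrow> x \<in> C \<and> y \<in> C \<and> x \<in> right_principal T y \<and> y \<in> right_principal T x"
proof -
  have refl: "z \<in> right_principal T z" if "z \<in> C" for z using that by (simp add: right_principal_iff)
  have "right_principal T x = right_principal T y \<longleftrightarrow>
    x \<in> right_principal T y \<and> y \<in> right_principal T x" if "x \<in> C" "y \<in> C"
    using that refl right_trans by blast
  thus ?thesis unfolding green_R_def by blast
qed

lemma green_L_iff:
  "(x, y) \<in> green_L T \<longleftrightarrow> x \<in> C \<and> y \<in> C \<and> x \<in> left_principal T y \<and> y \<in> left_principal T x"
proof -
  have refl: "z \<in> left_principal T z" if "z \<in> C" for z using that by (simp add: left_principal_iff)
  have "left_principal T x = left_principal T y \<longleftrightarrow>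
    x \<in> left_principal T y \<and> y \<in> left_principal T x" if "x \<in> C" "y \<in> C"
    using that refl left_trans by blast
  thus ?thesis unfolding green_L_def by blast
qed

lemma nabla_congruence: "congruence T (nabla T)"
  by (rule congruenceI) (auto simp: nabla_def parallel_def composable_def)

text \<open>A representative \<open>m\<close> generates every element of \<open>T\<close>, so being
  \<open>green_J\<close>-related to \<open>m\<close> means generating \<open>m\<close> and hence
  everything. The right-hand side does not depend on \<open>M\<close>, which makes a maximum class
  unique.\<close>

lemma is_max_J_class_eq:
  assumes "is_max_J_class T M"
  shows "M = {x \<in> C. C \<subseteq> two_sided_principal T x}"
proof -
  obtain m where m: "m \<in> C" "M = J_class T m"
    using assms by (auto simp: is_max_J_class_def quotient_def)
  have top: "x \<in> two_sided_principal T m" if "x \<in> C" for x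
  proof -
    have "J_class T x \<in> C // green_J T" using that by (auto simp: quotient_def)
    hence "J_le T (J_class T x) M" using assms by (auto simp: is_max_J_class_def)
    \<comment> \<open>\<open>J_le\<close> compares classes through some pair of representatives,
      which need not be \<open>x\<close> and \<open>m\<close>; both have to be carried back along
      \<open>green_J\<close>.\<close>
    then obtain x' y' where *: "x' \<in> C" "y' \<in> C" "J_class T x = J_class T x'" "M = J_class T y'"
        "x' \<in> two_sided_principal T y'" by (auto simp: J_le_def)
    have "x \<in> J_class T x'" using *(3) that two_sided_refl by (metis Image_singleton_iff green_J_iff)
    moreover have "m \<in> J_class T y'" using *(4) m two_sided_refl by (metis Image_singleton_iff green_J_iff)
    ultimately have "x \<in> two_sided_principal T x'" "y' \<in> two_sided_principal T m"
      unfolding Image_singleton_iff green_J_iff by blast+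
    thus ?thesis using *(1,2,5) two_sided_trans m by blast
  qed
  have "x \<in> M \<longleftrightarrow> x \<in> C \<and> C \<subseteq> two_sided_principal T x" for x
  proof -
    have "x \<in> M \<longleftrightarrow> x \<in> C \<and> m \<in> two_sided_principal T x" 
      using top m by (auto simp: green_J_iff)
    thus ?thesis using top two_sided_trans m by blast
  qed
  thus ?thesis by blast
qed

end

section \<open>The maximum regular stable \<open>\<J>\<close>-class\<close>

locale max_J_sg = partial_sg +
  assumes Dmax: "Dmax T"
begin

abbreviation D where "D \<equiv> max_J_class T"

text \<open>The maximum class exists by \<open>Dmax\<close> and is unique by its explicit
  description, so the definite choice in \<open>max_J_class\<close> is meaningful.\<close>

lemma is_max_D: "is_max_J_class T D"
proof -
  obtain M where M: "is_max_J_class T M" using Dmax by (auto simp: Dmax_def)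
  have "N = M" if "is_max_J_class T N" for N
    using is_max_J_class_eq[OF M] is_max_J_class_eq[OF that] by simp
  with M show ?thesis unfolding max_J_class_def by (rule theI)
qed

lemma D_eq: "D = {x \<in> C. C \<subseteq> two_sided_principal T x}"
  by (rule is_max_J_class_eq[OF is_max_D])

lemma regular_D: "x \<in> D \<Longrightarrow> regular_elem T x" and stable_D: "stable_J_class T D"
proof -
  obtain M where "is_max_J_class T M" "\<forall>x\<in>M. regular_elem T x" "stable_J_class T M"
    using Dmax by (auto simp: Dmax_def)
  moreover have "M = D"
    using is_max_J_class_eq[OF is_max_D] is_max_J_class_eq[OF \<open>is_max_J_class T M\<close>] by simp
  ultimately show "x \<in> D \<Longrightarrow> regular_elem T x" "stable_J_class T D" by auto
qed

section \<open>Divisibility and cancellation in the maximum class\<close>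

lemma D_subset: "D \<subseteq> C" using D_eq by blast

lemma D_in_C [simp]: "x \<in> D \<Longrightarrow> x \<in> C" using D_subset by blast

lemma D_green_J: "x \<in> D \<Longrightarrow> y \<in> D \<Longrightarrow> (x, y) \<in> green_J T"
  unfolding green_J_iff using D_eq by blast

text \<open>A product lies in the principal ideal of each of its factors, so a factor of an element
  that generates \<open>T\<close> generates \<open>T\<close> too. Hence multiplication never leads
  from outside back into \<open>D\<close>.\<close>

lemma D_factors:
  assumes "x \<in> C" "y \<in> C" "rn x = dm y" "x \<cdot> y \<in> D"
  shows "x \<in> D" "y \<in> D"
proof -
  have "x \<cdot> y \<in> two_sided_principal T x" "x \<cdot> y \<in> two_sided_principal T y"
    using assms two_sided_principal_iff by blast+
  thus "x \<in> D" "y \<in> D" using assms two_sided_trans unfolding D_eq by blast+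
qed

lemma D_regular:
  assumes "x \<in> D"
  obtains c where "c \<in> C" "rn x = dm c" "rn c = dm x" "x \<cdot> (c \<cdot> x) = x"
proof -
  obtain c where "c \<in> C" "rn x = dm c" "rn c = dm x" "x = x \<cdot> c \<cdot> x"
    using regular_D[OF assms] by (auto simp: regular_elem_def composable_def)
  with assms show ?thesis by (intro that[of c]) (metis assoc D_in_C)+
qed

text \<open>Regularity gives \<open>x = (x c) x = x (c x)\<close>, so \<open>x \<cdot> c\<close> and
  \<open>c \<cdot> x\<close> replace the adjoined identities and both multipliers can be taken in
  \<open>T\<close>.\<close>

lemma D_generates:
  assumes "x \<in> D" "u \<in> C"
  shows "\<exists>a\<in>C. \<exists>b\<in>C. rn a = dm x \<and> dm b = rn x \<and> u = a \<cdot> (x \<cdot> b)"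
proof -
  obtain c where c: "c \<in> C" "rn x = dm c" "rn c = dm x" "x \<cdot> (c \<cdot> x) = x"
    using assms D_regular by blast
  have x: "x \<in> C" using assms by simp
  have *: "x \<cdot> c \<cdot> (x \<cdot> (c \<cdot> x)) = x" using c x by simp
  have "u \<in> two_sided_principal T x" using assms D_eq by blast
  then consider "u = x" | s where "s\<in>C" "rn x = dm s" "u = x \<cdot> s" |
    t where "t\<in>C" "rn t = dm x" "u = t \<cdot> x" |
    t s where "t\<in>C" "s\<in>C" "rn t = dm x" "rn x = dm s" "u = t \<cdot> (x \<cdot> s)"
    using two_sided_principal_iff[OF x] x by auto
  thus ?thesis
  proof cases
    case 1
    thus ?thesis using * c x by (intro bexI[of _ "x \<cdot> c"] bexI[of _ "c \<cdot> x"]) auto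
  next
    case (2 s)
    hence "u = (x \<cdot> c) \<cdot> (x \<cdot> s)" using c x assoc[of x "c \<cdot> x" s] by simp
    thus ?thesis using 2 c x by (intro bexI[of _ "x \<cdot> c"] bexI[of _ s]) auto
  next
    case (3 t)
    thus ?thesis using c x by (intro bexI[of _ t] bexI[of _ "c \<cdot> x"]) auto
  next
    case (4 t s)
    thus ?thesis using x by (intro bexI[of _ t] bexI[of _ s]) auto
  qed
qed

text \<open>\<open>x\<close> and \<open>x \<cdot> a\<close> are both in \<open>D\<close>, so
  stability makes them \<open>green_R\<close>-related, and \<open>x\<close> is obtained from
  \<open>x \<cdot> a\<close> by a multiplier on the right.\<close>

lemma D_right_cancel:
  assumes "x \<in> D" "a \<in> C" "rn x = dm a" "x \<cdot> a \<in> D"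
  shows "\<exists>b\<in>C. rn a = dm b \<and> rn b = rn x \<and> x = x \<cdot> (a \<cdot> b)"
proof -
  obtain c where c: "c \<in> C" "rn x = dm c" "rn c = dm x" "x \<cdot> (c \<cdot> x) = x"
    using assms D_regular by blast
  have "(x, x \<cdot> a) \<in> green_R T"
    using assms stable_D D_green_J by (auto simp: stable_J_class_def composable_def)
  hence "x \<in> right_principal T (x \<cdot> a)" by (simp add: green_R_iff)
  then consider "x \<cdot> a = x" | b where "b \<in> C" "rn a = dm b" "x = x \<cdot> (a \<cdot> b)"
    using assms right_principal_iff[of "x \<cdot> a" x] by (metis D_in_C assoc comp_simps(1,3))
  thus ?thesis
  proof cases
    \<comment> \<open>Here \<open>x\<close> comes from \<open>x \<cdot> a\<close> by an adjoined
      identity; as \<open>x \<cdot> (c \<cdot> x) = x\<close>, the element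
      \<open>c \<cdot> x\<close> serves instead.\<close>
    case 1
    hence "rn a = rn x" by (metis assms D_in_C comp_simps(3))
    moreover have "x \<cdot> (a \<cdot> (c \<cdot> x)) = x \<cdot> a \<cdot> (c \<cdot> x)"
      using c assms \<open>rn a = rn x\<close> by simp
    ultimately show ?thesis using 1 c assms by (intro bexI[of _ "c \<cdot> x"]) auto
  next
    case (2 b)
    hence "rn b = rn x" using assms by (metis D_in_C comp_simps)
    with 2 show ?thesis by blast
  qed
qed

lemma D_left_cancel:
  assumes "x \<in> D" "a \<in> C" "rn a = dm x" "a \<cdot> x \<in> D"
  shows "\<exists>b\<in>C. rn b = dm a \<and> dm b = dm x \<and> x = b \<cdot> (a \<cdot> x)"
proof -
  obtain c where c: "c \<in> C" "rn x = dm c" "rn c = dm x" "x \<cdot> (c \<cdot> x) = x"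
    using assms D_regular by blast
  have "(x, a \<cdot> x) \<in> green_L T"
    using assms stable_D D_green_J by (auto simp: stable_J_class_def composable_def)
  hence "x \<in> left_principal T (a \<cdot> x)" by (simp add: green_L_iff)
  then consider "a \<cdot> x = x" | b where "b \<in> C" "rn b = dm a" "x = b \<cdot> (a \<cdot> x)"
    using assms left_principal_iff[of "a \<cdot> x" x] by (metis D_in_C comp_simps(1,2))
  thus ?thesis
  proof cases
    case 1
    hence "dm a = dm x" by (metis assms D_in_C comp_simps(2))
    moreover have "x \<cdot> c \<cdot> (a \<cdot> x) = x"
      using 1 c assms \<open>dm a = dm x\<close> by simp
    ultimately show ?thesis using c assms by (intro bexI[of _ "x \<cdot> c"]) auto
  next
    case (2 b)
    hence "dm b = dm x" using assms by (metis D_in_C comp_simps)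
    with 2 show ?thesis by blast
  qed
qed

text \<open>\<open>x\<close> is \<open>y\<close> or a right multiple of \<open>y\<close>, so
  \<open>y\<close> is in \<open>D\<close>. When \<open>y = x\<close>, regularity still supplies
  multipliers in \<open>T\<close>, namely \<open>c \<cdot> x\<close> and
  \<open>x \<cdot> c\<close>.\<close>

lemma H_class_D:
  assumes "x \<in> D" "y \<in> H_class T x"
  shows "y \<in> D" "dm y = dm x" "rn y = rn x" 
    "\<exists>s\<in>C. rn x = dm s \<and> y = x \<cdot> s" "\<exists>t\<in>C. rn t = dm x \<and> y = t \<cdot> x"
proof -
  obtain c where c: "c \<in> C" "rn x = dm c" "rn c = dm x" "x \<cdot> (c \<cdot> x) = x"
    using assms D_regular by blast
  have *: "y \<in> C" "y \<in> right_principal T x" "y \<in> left_principal T x" "x \<in> right_principal T y"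
    using assms(2) by (auto simp: green_H_def green_R_iff green_L_iff)
  then consider "x = y" | s where "s \<in> C" "rn y = dm s" "x = y \<cdot> s"
    by (auto simp: right_principal_iff)
  thus "y \<in> D"
    using *(1) D_factors(1)[of y] assms(1) by cases metis+
  show s: "\<exists>s\<in>C. rn x = dm s \<and> y = x \<cdot> s"
  proof (cases "y = x")
    case True
    thus ?thesis using c assms by (intro bexI[of _ "c \<cdot> x"]) auto
  qed (use * assms in \<open>auto simp: right_principal_iff\<close>)
  show t: "\<exists>t\<in>C. rn t = dm x \<and> y = t \<cdot> x"
  proof (cases "y = x")
    case True
    thus ?thesis using c assms by (intro bexI[of _ "x \<cdot> c"]) auto
  qed (use * assms in \<open>auto simp: left_principal_iff\<close>)
  show "dm y = dm x" using s assms by auto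
  show "rn y = rn x" using t assms by auto
qed

end

section \<open>Coordinates relative to a group \<open>\<H>\<close>-class\<close>

locale group_H_sg = max_J_sg +
  fixes G :: "'a set"
  assumes group_H: "group_H_class T G" and G_subset_D: "G \<subseteq> D"
begin

sublocale grp: group "H_group T G"
  using group_H by (simp add: group_H_class_def)

abbreviation e where "e \<equiv> \<one>\<^bsub>H_group T G\<^esub>"
abbreviation ginv where "ginv x \<equiv> inv\<^bsub>H_group T G\<^esub> x"

definition ob where "ob = dm e"

lemma H_group_sel [simp]: "carrier (H_group T G) = G" "x \<otimes>\<^bsub>H_group T G\<^esub> y = x \<cdot> y"
  by (simp_all add: H_group_def)

lemma e_in_G [simp]: "e \<in> G"
  using grp.one_closed by simp

lemma G_simps [simp]:
  assumes "x \<in> G"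
  shows "x \<in> D" "dm x = ob" "rn x = ob" "e \<cdot> x = x" "x \<cdot> e = x"
    "ginv x \<in> G" "x \<cdot> ginv x = e" "ginv x \<cdot> x = e"
proof -
  have c: "rn y = dm z" if "y \<in> G" "z \<in> G" for y z
    using group_H that unfolding group_H_class_def composable_def by blast
  show "x \<in> D" using assms G_subset_D by blast
  show "rn x = ob" using c[OF assms e_in_G] by (simp add: ob_def)
  have "dm x = rn e" using c[OF e_in_G assms] by simp
  also have "rn e = ob" using c[OF e_in_G e_in_G] by (simp add: ob_def)
  finally show "dm x = ob" .
  show "e \<cdot> x = x" "x \<cdot> e = x" "ginv x \<in> G" "x \<cdot> ginv x = e" "ginv x \<cdot> x = e"
    using grp.l_one grp.r_one grp.inv_closed grp.r_inv grp.l_inv assms by auto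
qed

lemma G_mult [simp]: "x \<in> G \<Longrightarrow> y \<in> G \<Longrightarrow> x \<cdot> y \<in> G"
  using grp.m_closed[of x y] by simp

text \<open>Stability makes such a \<open>g\<close> invertible up to \<open>e\<close> on each side,
  \<open>e = g \<cdot> b\<close> and \<open>e = a \<cdot> g\<close>. So \<open>g\<close> is
  \<open>green_H\<close>-related to \<open>e\<close>, and that class is \<open>G\<close>.\<close>

lemma G_I:
  assumes "g \<in> D" "dm g = ob" "rn g = ob" "e \<cdot> g = g" "g \<cdot> e = g"
  shows "g \<in> G"
proof -
  have e: "e \<in> D" "e \<in> C" and g: "g \<in> C" using assms by simp_all
  obtain b where b: "b \<in> C" "rn g = dm b" "e = e \<cdot> (g \<cdot> b)"
    using D_right_cancel[of e g] assms e by auto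
  have "e \<cdot> g \<cdot> b = e \<cdot> (g \<cdot> b)" using b(1,2) assms e g by (intro assoc) simp_all
  hence "e = g \<cdot> b" using b(3) assms(4) by simp
  hence "e \<in> right_principal T g" using b g assms by (metis right_principal_iff)
  moreover have "g \<in> right_principal T e"
    using assms e g by (metis G_simps(3) e_in_G right_principal_iff)
  moreover obtain a where a: "a \<in> C" "rn a = dm g" "e = a \<cdot> (g \<cdot> e)"
    using D_left_cancel[of e g] assms e by auto
  hence "e \<in> left_principal T g" using g assms by (metis left_principal_iff)
  moreover have "g \<in> left_principal T e"
    using assms e g by (metis G_simps(2) e_in_G left_principal_iff)
  ultimately have eg: "(e, g) \<in> green_H T"
    using e g by (simp add: green_H_def green_R_iff green_L_iff)
  obtain h where h: "G = H_class T h"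
    using group_H by (auto simp: group_H_class_def quotient_def)
  hence "(h, e) \<in> green_H T" using e_in_G by blast
  hence "(h, g) \<in> green_H T" using eg by (auto simp: green_H_def green_R_def green_L_def)
  thus ?thesis using h by blast
qed

text \<open>The \<open>\<L>\<close>-class and the \<open>\<R>\<close>-class of \<open>e\<close>.\<close>

definition LA :: "'a set" where
  "LA = {a \<in> C. rn a = ob \<and> a \<cdot> e = a \<and>
    (\<exists>a'\<in>C. dm a' = ob \<and> rn a' = dm a \<and> e \<cdot> a' = a' \<and> a' \<cdot> a = e)}"

definition RB :: "'a set" where
  "RB = {b \<in> C. dm b = ob \<and> e \<cdot> b = b \<and>
    (\<exists>b'\<in>C. dm b' = rn b \<and> rn b' = ob \<and> b' \<cdot> e = b' \<and> b \<cdot> b' = e)}"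

lemma LA_simps [simp]: "a \<in> LA \<Longrightarrow> a \<in> C" "a \<in> LA \<Longrightarrow> rn a = ob" "a \<in> LA \<Longrightarrow> a \<cdot> e = a"
  by (simp_all add: LA_def)

lemma RB_simps [simp]: "b \<in> RB \<Longrightarrow> b \<in> C" "b \<in> RB \<Longrightarrow> dm b = ob" "b \<in> RB \<Longrightarrow> e \<cdot> b = b"
  by (simp_all add: RB_def)

text \<open>The last equation is \<open>a' \<cdot> a = e\<close> prolonged by \<open>z\<close>, the
  form in which this cancellation occurs inside products bracketed to the right.\<close>

lemma LA_obtain:
  assumes "a \<in> LA"
  obtains a' where "a' \<in> C" "dm a' = ob" "rn a' = dm a" "e \<cdot> a' = a'" "a' \<cdot> a = e"
    "\<And>z. z \<in> C \<Longrightarrow> dm z = ob \<Longrightarrow> a' \<cdot> (a \<cdot> z) = e \<cdot> z"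
proof -
  obtain a' where a': "a' \<in> C" "dm a' = ob" "rn a' = dm a" "e \<cdot> a' = a'" "a' \<cdot> a = e"
    using assms unfolding LA_def by blast
  have "a' \<cdot> (a \<cdot> z) = e \<cdot> z" if "z \<in> C" "dm z = ob" for z
  proof -
    have "a' \<cdot> (a \<cdot> z) = a' \<cdot> a \<cdot> z"
      using a'(1-3) assms that by (intro assoc[symmetric]) simp_all
    thus ?thesis using a'(5) by simp
  qed
  with a' show ?thesis by (rule that)
qed

lemma RB_obtain:
  assumes "b \<in> RB"
  obtains b' where "b' \<in> C" "dm b' = rn b" "rn b' = ob" "b' \<cdot> e = b'" "b \<cdot> b' = e"
    "\<And>z. z \<in> C \<Longrightarrow> dm z = ob \<Longrightarrow> b \<cdot> (b' \<cdot> z) = e \<cdot> z"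
proof -
  obtain b' where b': "b' \<in> C" "dm b' = rn b" "rn b' = ob" "b' \<cdot> e = b'" "b \<cdot> b' = e"
    using assms unfolding RB_def by blast
  have "b \<cdot> (b' \<cdot> z) = e \<cdot> z" if "z \<in> C" "dm z = ob" for z
  proof -
    have "b \<cdot> (b' \<cdot> z) = b \<cdot> b' \<cdot> z"
      using b'(1-3) assms that by (intro assoc[symmetric]) simp_all
    thus ?thesis using b'(5) by simp
  qed
  with b' show ?thesis by (rule that)
qed

text \<open>Since \<open>a \<cdot> e = a\<close> is in \<open>D\<close>, stability returns
  \<open>e = s \<cdot> a\<close> for some \<open>s\<close>; replacing \<open>s\<close> by
  \<open>e \<cdot> s\<close> gives an inverse fixed by \<open>e\<close>.\<close>

lemma LA_I:
  assumes "a \<in> D" "rn a = ob" "a \<cdot> e = a"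
  shows "a \<in> LA"
proof -
  obtain s where s: "s \<in> C" "rn s = dm a" "dm s = ob" "s \<cdot> a = e"
    using D_left_cancel[of e a] assms by auto
  have "e \<cdot> (s \<cdot> a) = e" using s by simp
  moreover have "e \<cdot> (e \<cdot> s) = e \<cdot> s" using s assoc[of e e s] by simp
  ultimately show ?thesis unfolding LA_def using s(1-3) assms by (auto intro!: bexI[of _ "e \<cdot> s"])
qed

lemma RB_I:
  assumes "b \<in> D" "dm b = ob" "e \<cdot> b = b"
  shows "b \<in> RB"
proof -
  obtain s where s: "s \<in> C" "rn b = dm s" "rn s = ob" "e \<cdot> (b \<cdot> s) = e"
    using D_right_cancel[of e b] assms by auto
  have "b \<cdot> s = e" using s assoc[of e b s] assms by simp
  hence "b \<cdot> (s \<cdot> e) = e" using s assoc[of b s e] assms by simp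
  thus ?thesis unfolding RB_def using s(1-3) assms by (auto intro!: bexI[of _ "s \<cdot> e"])
qed

section \<open>Factorizations of elements of the maximum class\<close>

lemma LA_D [simp]:
  assumes "a \<in> LA"
  shows "a \<in> D"
proof -
  obtain a' where "a' \<in> C" "rn a' = dm a" "a' \<cdot> a = e"
    using assms LA_obtain by metis
  thus ?thesis using D_factors(2)[of a' a] assms by simp
qed

lemma RB_D [simp]:
  assumes "b \<in> RB"
  shows "b \<in> D"
proof -
  obtain b' where "b' \<in> C" "dm b' = rn b" "b \<cdot> b' = e"
    using assms RB_obtain by metis
  thus ?thesis using D_factors(1)[of b b'] assms by simp
qed

text \<open>\<open>e\<close> generates \<open>T\<close>, so \<open>u = p e q = (p e) (e q)\<close>,
  and both factors are in \<open>D\<close> because \<open>u\<close> is.\<close>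

lemma D_coords:
  assumes "u \<in> D"
  obtains a b where "a \<in> LA" "b \<in> RB" "u = a \<cdot> b"
proof -
  obtain p q where pq: "p \<in> C" "q \<in> C" "rn p = ob" "dm q = ob" "u = p \<cdot> (e \<cdot> q)"
    using D_generates[of e u] assms by auto
  have eq: "e \<cdot> (e \<cdot> q) = e \<cdot> q" using pq assoc[of e e q] by simp
  have u: "u = (p \<cdot> e) \<cdot> (e \<cdot> q)" using pq by (simp add: eq)
  have pe: "p \<cdot> e \<in> C" "e \<cdot> q \<in> C" "rn (p \<cdot> e) = dm (e \<cdot> q)" using pq(1-4) by simp_all
  have "p \<cdot> e \<cdot> (e \<cdot> q) \<in> D" using u assms by (simp only:)
  hence "p \<cdot> e \<in> D" "e \<cdot> q \<in> D" using D_factors[OF pe] by blast+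
  hence "p \<cdot> e \<in> LA" "e \<cdot> q \<in> RB"
    using pq(1-4) by (auto intro!: LA_I RB_I simp: eq)
  thus ?thesis using that u by blast
qed

text \<open>\<open>a'\<close> and \<open>b'\<close> invert \<open>a\<close> and \<open>b\<close> up
  to \<open>e\<close>. They do not depend on \<open>g\<close>, so one pair of multipliers recovers
  the middle factors of two elements at once.\<close>

lemma coords_recover:
  assumes "a \<in> LA" "b \<in> RB"
  obtains a' b' where "a' \<in> C" "b' \<in> C" "rn a' = dm a" "dm b' = rn b"
    "\<And>g. g \<in> G \<Longrightarrow> a' \<cdot> (a \<cdot> (g \<cdot> b)) \<cdot> b' = g"
proof -
  obtain a' where a': "a' \<in> C" "dm a' = ob" "rn a' = dm a"
    "\<And>z. z \<in> C \<Longrightarrow> dm z = ob \<Longrightarrow> a' \<cdot> (a \<cdot> z) = e \<cdot> z"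
    using assms(1) LA_obtain by metis
  obtain b' where b': "b' \<in> C" "dm b' = rn b" "rn b' = ob" "b \<cdot> b' = e"
    using assms(2) RB_obtain by metis
  have "a' \<cdot> (a \<cdot> (g \<cdot> b)) \<cdot> b' = g" if "g \<in> G" for g
    using assms a' b' that by (simp del: assoc) (simp add: assms that)
  with a' b' show ?thesis by (intro that[of a' b'])
qed

text \<open>The product can be multiplied back to \<open>g\<close>, hence is a factor of an element
  of \<open>D\<close>.\<close>

lemma coords_D:
  assumes "a \<in> LA" "g \<in> G" "b \<in> RB"
  shows "a \<cdot> (g \<cdot> b) \<in> D"
proof -
  obtain a' b' where *: "a' \<in> C" "b' \<in> C" "rn a' = dm a" "dm b' = rn b"
    "a' \<cdot> (a \<cdot> (g \<cdot> b)) \<cdot> b' = g"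
    using coords_recover[OF assms(1,3)] assms(2) by metis
  have "a' \<cdot> (a \<cdot> (g \<cdot> b)) \<cdot> b' \<in> D" unfolding *(5) using assms by simp
  hence "a' \<cdot> (a \<cdot> (g \<cdot> b)) \<in> D" by (rule D_factors(1)[rotated 3]) (use assms *(1-4) in simp_all)
  thus ?thesis by (rule D_factors(2)[rotated 3]) (use assms *(1-4) in simp_all)
qed

lemma coords_cancel:
  assumes "a \<in> LA" "x \<in> G" "y \<in> G" "b \<in> RB" "a \<cdot> (x \<cdot> b) = a \<cdot> (y \<cdot> b)"
  shows "x = y"
  using coords_recover[OF assms(1,4)] assms(2,3,5) by metis

text \<open>This is the change of coordinates between two factorizations of one element, needed to
  compare two pairs of \<open>nu\<close> that share a member.\<close>

lemma coords_transfer: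
  assumes "a \<in> LA" "c \<in> LA" "b \<in> RB" "d \<in> RB" "x \<in> G" "z \<in> G"
    and eq: "a \<cdot> (x \<cdot> b) = c \<cdot> (z \<cdot> d)"
  obtains g k where "g \<in> G" "k \<in> G" "a = c \<cdot> g" "b = k \<cdot> d"
proof -
  obtain a' where a': "a' \<in> C" "dm a' = ob" "rn a' = dm a" "e \<cdot> a' = a'"
    "\<And>z. z \<in> C \<Longrightarrow> dm z = ob \<Longrightarrow> a' \<cdot> (a \<cdot> z) = e \<cdot> z"
    using assms(1) LA_obtain by metis
  obtain b' where b': "b' \<in> C" "dm b' = rn b" "rn b' = ob" "b' \<cdot> e = b'" "b \<cdot> b' = e"
    "\<And>z. z \<in> C \<Longrightarrow> dm z = ob \<Longrightarrow> b \<cdot> (b' \<cdot> z) = e \<cdot> z"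
    using assms(3) RB_obtain by metis
  have "dm a = dm (a \<cdot> (x \<cdot> b))" "rn b = rn (a \<cdot> (x \<cdot> b))" using assms(1-6) by simp_all
  hence ac: "dm a = dm c" and bd: "rn b = rn d" unfolding eq using assms(1-6) by simp_all
  \<comment> \<open>Solving \<open>a x b = c z d\<close> for \<open>a\<close> cancels
    \<open>b\<close> by \<open>b'\<close> and \<open>x\<close> by \<open>ginv x\<close> on the
    right; solving for \<open>b\<close> cancels by \<open>a'\<close> and \<open>ginv x\<close> on
    the left.\<close>
  define g where "g = z \<cdot> (d \<cdot> (b' \<cdot> ginv x))"
  define k where "k = ginv x \<cdot> (a' \<cdot> (c \<cdot> z))"
  have "c \<cdot> g = c \<cdot> (z \<cdot> d) \<cdot> (b' \<cdot> ginv x)" unfolding g_def using assms(1-6) b' bd by simp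
  also have "\<dots> = a \<cdot> (x \<cdot> (b \<cdot> (b' \<cdot> ginv x)))" unfolding eq[symmetric] using assms(1-6) b' by simp
  also have "\<dots> = a" using assms(1-6) b'(6)[of "ginv x"] by simp
  finally have g: "a = c \<cdot> g" ..
  have "k \<cdot> d = ginv x \<cdot> (a' \<cdot> (c \<cdot> (z \<cdot> d)))" unfolding k_def using assms(1-6) a' ac by simp
  also have "\<dots> = ginv x \<cdot> (a' \<cdot> (a \<cdot> (x \<cdot> b)))" unfolding eq ..
  also have "\<dots> = ginv x \<cdot> (e \<cdot> (x \<cdot> b))" using assms(1-6) a'(5)[of "x \<cdot> b"] by simp
  also have "\<dots> = ginv x \<cdot> (e \<cdot> x) \<cdot> b" using assms(1-6) by (simp del: G_simps(4))
  also have "\<dots> = b" using assms(1-6) by (simp del: assoc)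
  finally have k: "b = k \<cdot> d" ..
  \<comment> \<open>\<open>g\<close> and \<open>k\<close> are factors of \<open>a\<close> and
    \<open>b\<close>, hence in \<open>D\<close>, and \<open>e\<close> fixes them on both sides;
    \<open>G_I\<close> then puts them in \<open>G\<close>.\<close>
  have gC: "g \<in> C" "dm g = ob" "rn g = ob" and kC: "k \<in> C" "dm k = ob" "rn k = ob"
    unfolding g_def k_def using assms(1-6) a' b' ac bd by simp_all
  have "g \<in> D" using D_factors(2)[of c g] g assms gC by simp
  moreover have "e \<cdot> g = g" unfolding g_def using assms(1-6) b' bd assoc[of e z "d \<cdot> (b' \<cdot> ginv x)"] by simp
  moreover have "g \<cdot> e = g" unfolding g_def using assms(1-6) b' bd by simp
  moreover have "k \<in> D" using D_factors(1)[of k d] k assms kC by simp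
  moreover have "e \<cdot> k = k" unfolding k_def using assms(1-6) a' ac assoc[of e "ginv x" "a' \<cdot> (c \<cdot> z)"] by simp
  moreover have "k \<cdot> e = k" unfolding k_def using assms(1-6) a' ac by simp
  ultimately have "g \<in> G" "k \<in> G" using G_I gC kC by blast+
  thus ?thesis using that g k by blast
qed

text \<open>As \<open>x = e x e\<close> on \<open>G\<close>, the multipliers \<open>a\<close> and
  \<open>b\<close> of a sandwich may be replaced by \<open>a e\<close> and \<open>e b\<close>, with
  \<open>e\<close> itself for an adjoined identity. These lie in \<open>D\<close> as factors of
  \<open>u\<close>, hence in \<open>LA\<close> and \<open>RB\<close>.\<close>

lemma nu_eq:
  assumes "N \<subseteq> G"
  shows "nu T D N = {(a \<cdot> (x \<cdot> b), a \<cdot> (y \<cdot> b)) | a x y b. a \<in> LA \<and> b \<in> RB \<and> x \<in> N \<and> y \<in> N}"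
    (is "_ = ?R")
proof (rule equalityI; rule subrelI)
  fix u v assume "(u, v) \<in> nu T D N"
  then obtain x y a b where *: "u \<in> D" "v \<in> D" "x \<in> N" "y \<in> N"
    "sandwich T a x b u" "sandwich T a y b v" by (auto simp: nu_def)
  have xy: "x \<in> G" "y \<in> G" using * assms by auto
  define p where "p = (case a of Inl s \<Rightarrow> s \<cdot> e | Inr c \<Rightarrow> e)"
  define q where "q = (case b of Inl s \<Rightarrow> e \<cdot> s | Inr c \<Rightarrow> e)"
  have pq: "p \<in> C" "rn p = ob" "p \<cdot> e = p" "q \<in> C" "dm q = ob" "e \<cdot> q = q"
    using *(5) xy unfolding p_def q_def sandwich_def composable_def adjoin_ids_def
    by (auto split: sum.splits simp flip: assoc[of e e])
  have eq: "w = p \<cdot> (g \<cdot> q)" if "sandwich T a g b w" "g \<in> G" for g w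
    using that unfolding p_def q_def sandwich_def composable_def adjoin_ids_def
    by (auto split: sum.splits simp flip: assoc[of e g] assoc[of g e])
  have u: "u = p \<cdot> (x \<cdot> q)" "v = p \<cdot> (y \<cdot> q)" using eq * xy by blast+
  have "p \<in> D" "x \<cdot> q \<in> D" using D_factors[of p "x \<cdot> q"] u(1) *(1) pq xy by simp_all
  moreover from this have "q \<in> D" using D_factors(2)[of x q] pq xy by simp
  ultimately have "p \<in> LA" "q \<in> RB" using pq LA_I RB_I by blast+
  with u * show "(u, v) \<in> ?R" by blast
next
  fix u v assume "(u, v) \<in> ?R"
  then obtain a b x y where *: "a \<in> LA" "b \<in> RB" "x \<in> N" "y \<in> N"
    "u = a \<cdot> (x \<cdot> b)" "v = a \<cdot> (y \<cdot> b)" by auto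
  have xy: "x \<in> G" "y \<in> G" using * assms by auto
  have "sandwich T (Inl a) g (Inl b) (a \<cdot> (g \<cdot> b))" if "g \<in> G" for g
    using that * by (auto simp: sandwich_def composable_def adjoin_ids_def)
  thus "(u, v) \<in> nu T D N" unfolding nu_def using * xy coords_D by blast
qed

end

section \<open>Congruences restricted to the ideal below the maximum class\<close>

context max_J_sg
begin

abbreviation S where "S \<equiv> C - D"

lemma S_ideal_left: "x \<in> S \<Longrightarrow> composable T t x \<Longrightarrow> t \<cdot> x \<in> S"
  using D_factors(2)[of t x] by (auto simp: composable_def)

lemma S_ideal_right: "x \<in> S \<Longrightarrow> composable T x t \<Longrightarrow> x \<cdot> t \<in> S"
  using D_factors(1)[of x t] by (auto simp: composable_def)

lemma partial_semigroup_S: "partial_semigroup (psg_restrict T S)"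
proof -
  have "composable T x y" "x \<in> S" if "composable (psg_restrict T S) x y" for x y
    using that by (auto simp: composable_def)
  thus ?thesis
    using partial_semigroup S_ideal_right unfolding partial_semigroup_def psg_restrict_simps
    by blast
qed

text \<open>Multiplying by any element of \<open>T\<close> keeps pairs inside the ideal
  \<open>S\<close>, and equal pairs stay equal; so adding only equality on \<open>D\<close> gives a
  congruence on \<open>T\<close>.\<close>

lemma restrict_congruence:
  assumes "congruence T \<rho>"
  shows "\<rho> \<inter> S \<times> S \<in> Cong_liftable T S"
proof -
  note c = congruenceD[OF assms]
  have in_C: "x \<in> C" "y \<in> C" if "(x, y) \<in> \<rho>" for x y using c(1) that by blast+
  have comp: "composable T t y" if "(x, y) \<in> \<rho>" "composable T t x" for x y t
    using that c(5) in_C by (auto simp: composable_def parallel_def)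
  have comp': "composable T y t" if "(x, y) \<in> \<rho>" "composable T x t" for x y t
    using that c(5) in_C by (auto simp: composable_def parallel_def)
  have l: "(t \<cdot> x, t \<cdot> y) \<in> \<rho> \<inter> S \<times> S" if "(x, y) \<in> \<rho> \<inter> S \<times> S" "composable T t x" for x y t
    using that c(6) S_ideal_left comp by blast
  have r: "(x \<cdot> t, y \<cdot> t) \<in> \<rho> \<inter> S \<times> S" if "(x, y) \<in> \<rho> \<inter> S \<times> S" "composable T x t" for x y t
    using that c(7) S_ideal_right comp' by blast
  have comp_S: "composable T x y" if "composable (psg_restrict T S) x y" for x y
    using that by (auto simp: composable_def)
  have "congruence (psg_restrict T S) (\<rho> \<inter> S \<times> S)"
  proof (rule congruenceI, unfold psg_restrict_simps)
    show "\<And>x y. (x, y) \<in> \<rho> \<inter> S \<times> S \<Longrightarrow> parallel T x y" using c(5) by blast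
    show "\<And>x y z. (x, y) \<in> \<rho> \<inter> S \<times> S \<Longrightarrow> (y, z) \<in> \<rho> \<inter> S \<times> S \<Longrightarrow> (x, z) \<in> \<rho> \<inter> S \<times> S"
      using c(4) by blast
  qed (use c(2,3) l r comp_S in blast)+
  moreover have "congruence T (\<rho> \<inter> S \<times> S \<union> Id_on C)"
  proof (rule congruenceI)
    show "parallel T x y" if "(x, y) \<in> \<rho> \<inter> S \<times> S \<union> Id_on C" for x y
      using that c(5) by (auto simp: parallel_def)
    show "(x, z) \<in> \<rho> \<inter> S \<times> S \<union> Id_on C"
      if "(x, y) \<in> \<rho> \<inter> S \<times> S \<union> Id_on C" "(y, z) \<in> \<rho> \<inter> S \<times> S \<union> Id_on C" for x y z
      using that c(4) by (auto simp: Id_on_iff)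
    show "(t \<cdot> x, t \<cdot> y) \<in> \<rho> \<inter> S \<times> S \<union> Id_on C"
      if "(x, y) \<in> \<rho> \<inter> S \<times> S \<union> Id_on C" "composable T t x" for x y t
      using that l[of x y t] by (auto simp: Id_on_iff composable_def)
    show "(x \<cdot> t, y \<cdot> t) \<in> \<rho> \<inter> S \<times> S \<union> Id_on C"
      if "(x, y) \<in> \<rho> \<inter> S \<times> S \<union> Id_on C" "composable T x t" for x y t
      using that r[of x y t] by (auto simp: Id_on_iff composable_def)
  qed (use c(3) in \<open>auto simp: Id_on_iff\<close>)
  ultimately show ?thesis by (simp add: Cong_liftable_def Cong_def)
qed

text \<open>Liftability provides the last two clauses, where the multiplier may be any element of
  \<open>T\<close>. A product starting from \<open>S\<close> stays in \<open>S\<close>, where the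
  equality pairs of the lift already belong to \<open>\<sigma>\<close>.\<close>

lemma liftableD:
  assumes "\<sigma> \<in> Cong_liftable T S"
  shows liftable_subset: "\<sigma> \<subseteq> S \<times> S"
    and liftable_refl: "x \<in> S \<Longrightarrow> (x, x) \<in> \<sigma>"
    and liftable_sym: "(x, y) \<in> \<sigma> \<Longrightarrow> (y, x) \<in> \<sigma>"
    and liftable_trans: "(x, y) \<in> \<sigma> \<Longrightarrow> (y, z) \<in> \<sigma> \<Longrightarrow> (x, z) \<in> \<sigma>"
    and liftable_parallel: "(x, y) \<in> \<sigma> \<Longrightarrow> parallel T x y"
    and liftable_left: "(x, y) \<in> \<sigma> \<Longrightarrow> composable T t x \<Longrightarrow> (t \<cdot> x, t \<cdot> y) \<in> \<sigma>"
    and liftable_right: "(x, y) \<in> \<sigma> \<Longrightarrow> composable T x t \<Longrightarrow> (x \<cdot> t, y \<cdot> t) \<in> \<sigma>"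
proof -
  have "congruence (psg_restrict T S) \<sigma>"
    using assms by (simp add: Cong_liftable_def Cong_def)
  note c = congruenceD[OF this, unfolded psg_restrict_simps]
  show sub: "\<sigma> \<subseteq> S \<times> S" and refl: "x \<in> S \<Longrightarrow> (x, x) \<in> \<sigma>" for x
    using c by blast+
  show "(x, y) \<in> \<sigma> \<Longrightarrow> (y, x) \<in> \<sigma>" "(x, y) \<in> \<sigma> \<Longrightarrow> (y, z) \<in> \<sigma> \<Longrightarrow> (x, z) \<in> \<sigma>"
    "(x, y) \<in> \<sigma> \<Longrightarrow> parallel T x y"
    using c(3,4,5) by blast+
  have "congruence T (\<sigma> \<union> Id_on C)"
    using assms by (simp add: Cong_liftable_def Cong_def)
  note d = congruenceD[OF this]
  show "(t \<cdot> x, t \<cdot> y) \<in> \<sigma>" if "(x, y) \<in> \<sigma>" "composable T t x"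
  proof -
    have "t \<cdot> x \<in> S" using that sub S_ideal_left by blast
    moreover have "(t \<cdot> x, t \<cdot> y) \<in> \<sigma> \<union> Id_on C" using d(6) that by blast
    ultimately show ?thesis using refl by (auto simp: Id_on_iff)
  qed
  show "(x \<cdot> t, y \<cdot> t) \<in> \<sigma>" if "(x, y) \<in> \<sigma>" "composable T x t"
  proof -
    have "x \<cdot> t \<in> S" using that sub S_ideal_right by blast
    moreover have "(x \<cdot> t, y \<cdot> t) \<in> \<sigma> \<union> Id_on C" using d(7) that by blast
    ultimately show ?thesis using refl by (auto simp: Id_on_iff)
  qed
qed

section \<open>Generating the largest congruence\<close>

lemma nabla_S_liftable: "nabla (psg_restrict T S) \<in> Cong_liftable T S"
proof -
  have "nabla (psg_restrict T S) = nabla T \<inter> S \<times> S" by (auto simp: nabla_def)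
  thus ?thesis using restrict_congruence[OF nabla_congruence] by simp
qed

text \<open>The restriction of \<open>\<rho>\<close> to \<open>S\<close> is a congruence on
  \<open>S\<close> containing a pair that generates the largest one there.\<close>

lemma nabla_S_subset:
  assumes "nabla_gen (psg_restrict T S)" and "congruence T \<rho>" and "(x, y) \<in> \<rho>"
    and "x \<in> max_J_class (psg_restrict T S)" and "y \<in> S - H_class (psg_restrict T S) x"
  shows "nabla (psg_restrict T S) \<subseteq> \<rho>"
proof -
  have "max_J_sg (psg_restrict T S)"
    using assms(1) partial_semigroup_S
    by (simp add: max_J_sg_def partial_sg_def max_J_sg_axioms_def nabla_gen_def)
  hence "x \<in> S" using max_J_sg.D_subset assms(4) by fastforce
  have "cong_gen (psg_restrict T S) {(x, y)} = nabla (psg_restrict T S)"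
    using assms(1,4,5) congruence_parallel[OF assms(2,3)] by (simp add: nabla_gen_def)
  moreover have "cong_gen (psg_restrict T S) {(x, y)} \<subseteq> \<rho> \<inter> S \<times> S"
    using restrict_congruence[OF assms(2)] assms(3,5) \<open>x \<in> S\<close>
    by (intro cong_gen_least) (auto simp: Cong_liftable_def Cong_def)
  ultimately show ?thesis by blast
qed

text \<open>Since \<open>x\<close> generates \<open>T\<close>, multiplying the pair
  \<open>(x, y)\<close> relates every element of \<open>D\<close> to one of the ideal
  \<open>S\<close>, where all parallel pairs are already related.\<close>

lemma nabla_subset:
  assumes \<rho>: "congruence T \<rho>" and S: "nabla (psg_restrict T S) \<subseteq> \<rho>"
    and xy: "(x, y) \<in> \<rho>" "x \<in> D" "y \<in> S"
  shows "nabla T \<subseteq> \<rho>"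
proof (rule subrelI)
  note c = congruenceD[OF \<rho>]
  have pxy: "dm y = dm x" "rn y = rn x" using c(5)[OF xy(1)] by (simp_all add: parallel_def)
  have ex: "\<exists>z' \<in> S. (z, z') \<in> \<rho>" if z: "z \<in> C" for z
  proof (cases "z \<in> D")
    case False
    thus ?thesis using z c(2) by blast
  next
    case True
    obtain a b where ab: "a \<in> C" "b \<in> C" "rn a = dm x" "dm b = rn x" "z = a \<cdot> (x \<cdot> b)"
      using D_generates[OF xy(2) z] by blast
    have b: "(x \<cdot> b, y \<cdot> b) \<in> \<rho>" using c(7)[OF xy(1)] ab xy by (simp add: composable_def)
    have "(z, a \<cdot> (y \<cdot> b)) \<in> \<rho>" using c(6)[OF b, of a] ab xy by (simp add: composable_def)
    moreover have "y \<cdot> b \<in> S" using S_ideal_right[OF xy(3), of b] ab xy pxy by (simp add: composable_def)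
    hence "a \<cdot> (y \<cdot> b) \<in> S" using S_ideal_left[of "y \<cdot> b" a] ab xy pxy by (simp add: composable_def)
    ultimately show ?thesis by blast
  qed
  fix z w assume "(z, w) \<in> nabla T"
  hence zw: "z \<in> C" "w \<in> C" "parallel T z w" by (auto simp: nabla_def)
  obtain z' where z': "z' \<in> S" "(z, z') \<in> \<rho>" using ex zw by blast
  obtain w' where w': "w' \<in> S" "(w, w') \<in> \<rho>" using ex zw by blast
  have "parallel T z' w'" using zw(3) c(5)[OF z'(2)] c(5)[OF w'(2)] by (simp add: parallel_def)
  hence "(z', w') \<in> nabla (psg_restrict T S)" using z' w' by (auto simp: nabla_def)
  hence "(z', w') \<in> \<rho>" using S by blast
  thus "(z, w) \<in> \<rho>" using z'(2) w'(2) c(3,4) by blast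
qed

text \<open>A pair inside \<open>D\<close> is first moved by (S2) to one crossing from
  \<open>D\<close> to \<open>S\<close>, and (S1) turns that into a pair that generates the largest
  congruence on \<open>S\<close>. The crossing pair then extends this to all of
  \<open>T\<close>.\<close>

lemma nabla_gen_of_Sep:
  assumes "Sep T" and gen: "nabla_gen (psg_restrict T S)"
  shows "nabla_gen T"
proof -
  have "cong_gen T {(x, y)} = nabla T"
    if xy: "x \<in> D" "y \<in> C - H_class T x" "parallel T x y" for x y
  proof
    show "cong_gen T {(x, y)} \<subseteq> nabla T"
      using xy by (intro cong_gen_least nabla_congruence) (auto simp: nabla_def)
    have "nabla T \<subseteq> \<rho>" if \<rho>: "congruence T \<rho>" "(x, y) \<in> \<rho>" for \<rho>
    proof -
      have "\<exists>x1 y1. (x1, y1) \<in> \<rho> \<and> x1 \<in> D \<and> y1 \<in> S"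
      proof (cases "y \<in> D")
        case True
        hence "\<exists>(x1, y1) \<in> cong_gen T {(x, y)}. x1 \<in> D \<and> y1 \<in> S"
          using assms(1) xy by (simp add: Sep_def Sep2_def below_max_def Let_def)
        thus ?thesis using cong_gen_least[OF \<rho>(1), of "{(x, y)}"] \<rho>(2) by blast
      qed (use xy \<rho> in blast)
      then obtain x1 y1 where 1: "(x1, y1) \<in> \<rho>" "x1 \<in> D" "y1 \<in> S" by blast
      have "parallel T x1 y1" using congruence_parallel[OF \<rho>(1) 1(1)] .
      hence "\<exists>(x2, y2) \<in> cong_gen T {(x1, y1)}. x2 \<in> max_J_class (psg_restrict T S) \<and>
          y2 \<in> S - H_class (psg_restrict T S) x2"
        using assms(1) 1 by (simp add: Sep_def Sep1_def below_max_def Let_def)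
      then obtain x2 y2 where 2: "(x2, y2) \<in> \<rho>" "x2 \<in> max_J_class (psg_restrict T S)"
          "y2 \<in> S - H_class (psg_restrict T S) x2"
        using cong_gen_least[OF \<rho>(1), of "{(x1, y1)}"] 1(1) by blast
      show ?thesis using nabla_subset[OF \<rho>(1) nabla_S_subset[OF gen \<rho>(1) 2] 1] .
    qed
    thus "nabla T \<subseteq> cong_gen T {(x, y)}" by (auto simp: cong_gen_def Cong_def)
  qed
  thus ?thesis using Dmax by (simp add: nabla_gen_def)
qed

end

section \<open>The relations \<open>\<nu>\<^sub>N\<close>\<close>

context group_H_sg
begin

lemma nuI:
  assumes "N \<subseteq> G" "a \<in> LA" "b \<in> RB" "x \<in> N" "y \<in> N"
  shows "(a \<cdot> (x \<cdot> b), a \<cdot> (y \<cdot> b)) \<in> nu T D N"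
  using assms nu_eq[OF assms(1)] by blast

lemma nuE:
  assumes "(u, v) \<in> nu T D N" "N \<subseteq> G"
  obtains a x y b where "a \<in> LA" "b \<in> RB" "x \<in> N" "y \<in> N" "u = a \<cdot> (x \<cdot> b)" "v = a \<cdot> (y \<cdot> b)"
  using assms nu_eq[OF assms(2)] by blast

lemma nu_subset_D: "nu T D N \<subseteq> D \<times> D"
  by (auto simp: nu_def)

lemma nu_mono: "M \<subseteq> N \<Longrightarrow> nu T D M \<subseteq> nu T D N"
  unfolding nu_def by blast

lemma nu_refl:
  assumes "N \<subseteq> G" "e \<in> N" "u \<in> D"
  shows "(u, u) \<in> nu T D N"
proof -
  obtain a b where ab: "a \<in> LA" "b \<in> RB" "u = a \<cdot> b" using D_coords assms(3) by blast
  hence "u = a \<cdot> (e \<cdot> b)" by simp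
  thus ?thesis using nuI assms ab by metis
qed

lemma nu_sym: "(u, v) \<in> nu T D N \<Longrightarrow> (v, u) \<in> nu T D N"
  unfolding nu_def by blast

lemma nu_parallel:
  assumes "N \<subseteq> G" "(u, v) \<in> nu T D N"
  shows "parallel T u v"
proof -
  obtain a x y b where *: "a \<in> LA" "b \<in> RB" "x \<in> N" "y \<in> N" "u = a \<cdot> (x \<cdot> b)" "v = a \<cdot> (y \<cdot> b)"
    using nuE[OF assms(2,1)] .
  have "x \<in> G" "y \<in> G" using * assms by auto
  with * show ?thesis by (simp add: parallel_def)
qed

text \<open>If \<open>t a x b\<close> is in \<open>D\<close>, so is its factor \<open>t a\<close>;
  thus only the coordinate in \<open>LA\<close> changes, while \<open>x\<close>, \<open>y\<close>
  and \<open>b\<close> stay the same.\<close>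

lemma nu_left:
  assumes "N \<subseteq> G" "(u, v) \<in> nu T D N" "composable T t u" "t \<cdot> u \<in> D"
  shows "(t \<cdot> u, t \<cdot> v) \<in> nu T D N"
proof -
  obtain a x y b where *: "a \<in> LA" "b \<in> RB" "x \<in> N" "y \<in> N" "u = a \<cdot> (x \<cdot> b)" "v = a \<cdot> (y \<cdot> b)"
    using nuE[OF assms(2,1)] .
  have xy: "x \<in> G" "y \<in> G" using * assms by auto
  have t: "t \<in> C" "rn t = dm a" using assms(3) * xy by (simp_all add: composable_def)
  have eq: "t \<cdot> u = t \<cdot> a \<cdot> (x \<cdot> b)" "t \<cdot> v = t \<cdot> a \<cdot> (y \<cdot> b)" using * xy t by simp_all
  have "t \<cdot> a \<in> D" 
    by (rule D_factors(1)[rotated 3, of _ "x \<cdot> b"]) (use assms(4) eq(1) * xy t in simp_all)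
  hence "t \<cdot> a \<in> LA" using * t by (intro LA_I) simp_all
  thus ?thesis unfolding eq using nuI * assms(1) by blast
qed

lemma nu_right:
  assumes "N \<subseteq> G" "(u, v) \<in> nu T D N" "composable T u t" "u \<cdot> t \<in> D"
  shows "(u \<cdot> t, v \<cdot> t) \<in> nu T D N"
proof -
  obtain a x y b where *: "a \<in> LA" "b \<in> RB" "x \<in> N" "y \<in> N" "u = a \<cdot> (x \<cdot> b)" "v = a \<cdot> (y \<cdot> b)"
    using nuE[OF assms(2,1)] .
  have xy: "x \<in> G" "y \<in> G" using * assms by auto
  have t: "t \<in> C" "rn b = dm t" using assms(3) * xy by (simp_all add: composable_def)
  have eq: "u \<cdot> t = a \<cdot> (x \<cdot> (b \<cdot> t))" "v \<cdot> t = a \<cdot> (y \<cdot> (b \<cdot> t))" using * xy t by simp_all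
  have "a \<cdot> x \<cdot> (b \<cdot> t) \<in> D" using assms(4) eq(1) * xy t by simp
  hence "b \<cdot> t \<in> D" 
    by (rule D_factors(2)[rotated 3]) (use * xy t in simp_all)
  moreover have "e \<cdot> (b \<cdot> t) = e \<cdot> b \<cdot> t" using * t by (intro assoc[symmetric]) simp_all
  hence "e \<cdot> (b \<cdot> t) = b \<cdot> t" using * by simp
  ultimately have "b \<cdot> t \<in> RB" using * t by (intro RB_I) simp_all
  thus ?thesis unfolding eq using nuI * assms(1) by blast
qed

section \<open>Normal subgroups and transitivity\<close>

lemma normalD:
  assumes "N \<lhd> H_group T G"
  shows normal_subset: "N \<subseteq> G" and normal_e: "e \<in> N"
    and normal_mult: "x \<in> N \<Longrightarrow> y \<in> N \<Longrightarrow> x \<cdot> y \<in> N"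
    and normal_inv: "x \<in> N \<Longrightarrow> ginv x \<in> N"
    and normal_conj: "x \<in> N \<Longrightarrow> g \<in> G \<Longrightarrow> g \<cdot> x \<cdot> ginv g \<in> N"
proof -
  interpret N: normal N "H_group T G" by fact
  show "N \<subseteq> G" "e \<in> N" "x \<in> N \<Longrightarrow> y \<in> N \<Longrightarrow> x \<cdot> y \<in> N" "x \<in> N \<Longrightarrow> ginv x \<in> N"
    "x \<in> N \<Longrightarrow> g \<in> G \<Longrightarrow> g \<cdot> x \<cdot> ginv g \<in> N"
    using N.subset N.one_closed N.m_closed[of x y] N.m_inv_closed[of x] N.inv_op_closed2[of g x]
    by simp_all
qed

text \<open>Both pairs are brought to the outer coordinates \<open>c\<close> and \<open>d\<close>,
  where \<open>u\<close> has middle factor \<open>g x k\<close> and \<open>g y k = z\<close> is in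
  \<open>N\<close>. Normality carries this membership over to \<open>g x k\<close>.\<close>

lemma nu_trans:
  assumes N: "N \<lhd> H_group T G" and "(u, v) \<in> nu T D N" "(v, w) \<in> nu T D N"
  shows "(u, w) \<in> nu T D N"
proof -
  note sub = normal_subset[OF N]
  obtain a x y b where 1: "a \<in> LA" "b \<in> RB" "x \<in> N" "y \<in> N" "u = a \<cdot> (x \<cdot> b)" "v = a \<cdot> (y \<cdot> b)"
    using nuE[OF assms(2) sub] .
  obtain c z t d where 2: "c \<in> LA" "d \<in> RB" "z \<in> N" "t \<in> N" "v = c \<cdot> (z \<cdot> d)" "w = c \<cdot> (t \<cdot> d)"
    using nuE[OF assms(3) sub] .
  have G: "x \<in> G" "y \<in> G" "z \<in> G" using 1 2 sub by auto
  obtain g k where gk: "g \<in> G" "k \<in> G" "a = c \<cdot> g" "b = k \<cdot> d"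
    using coords_transfer[of a c b d y z] 1 2 G by metis
  have eq: "a \<cdot> (s \<cdot> b) = c \<cdot> (g \<cdot> s \<cdot> k \<cdot> d)" if "s \<in> G" for s
    unfolding gk(3,4) using that gk(1,2) 1(1,2) 2(1,2) by simp
  have "g \<cdot> y \<cdot> k = z"
    by (rule coords_cancel[of c _ _ d]) (use eq[of y] 1 2 G gk(1,2) in simp_all)
  moreover have cancel: "ginv p \<cdot> (p \<cdot> q) = q" if "p \<in> G" "q \<in> G" for p q
    using assoc[of "ginv p" p q] that by simp
  \<comment> \<open>With \<open>g y k\<close> split off on the right, what remains is the conjugate
    of \<open>x \<cdot> ginv y\<close> by \<open>g\<close>.\<close>
  have "g \<cdot> x \<cdot> k = g \<cdot> (x \<cdot> ginv y) \<cdot> ginv g \<cdot> (g \<cdot> y \<cdot> k)"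
    using G gk(1,2) by (simp add: cancel)
  ultimately have "g \<cdot> x \<cdot> k = g \<cdot> (x \<cdot> ginv y) \<cdot> ginv g \<cdot> z" by simp
  also have "\<dots> \<in> N"
    using normal_mult[OF N normal_conj[OF N normal_mult[OF N 1(3) normal_inv[OF N 1(4)]] gk(1)] 2(3)] .
  finally have "(c \<cdot> (g \<cdot> x \<cdot> k \<cdot> d), c \<cdot> (t \<cdot> d)) \<in> nu T D N" using nuI[OF sub] 2 by blast
  thus ?thesis using eq[of x] G 1 2 by simp
qed

text \<open>Write \<open>u = a b = a e b\<close>. As \<open>v\<close> is both a right and a left
  multiple of \<open>u\<close>, it is fixed by \<open>a a'\<close> on the left and by
  \<open>b' b\<close> on the right; hence \<open>v = a g b\<close> with
  \<open>g = a' v b'\<close>.\<close>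

lemma H_class_nu:
  assumes "u \<in> D" "v \<in> H_class T u"
  shows "(u, v) \<in> nu T D G"
proof -
  obtain a b where ab: "a \<in> LA" "b \<in> RB" "u = a \<cdot> b" using D_coords assms(1) by blast
  obtain s where s: "s \<in> C" "rn b = dm s" "v = a \<cdot> (b \<cdot> s)"
    using H_class_D(4)[OF assms] ab by auto
  obtain t where t: "t \<in> C" "rn t = dm a" "v = t \<cdot> (a \<cdot> b)"
    using H_class_D(5)[OF assms] ab by auto
  have v: "v \<in> D" "dm v = dm a" "rn v = rn b" "v \<in> C" using H_class_D(1-3)[OF assms] ab by simp_all
  obtain a' where a': "a' \<in> C" "dm a' = ob" "rn a' = dm a" "e \<cdot> a' = a'"
    "\<And>z. z \<in> C \<Longrightarrow> dm z = ob \<Longrightarrow> a' \<cdot> (a \<cdot> z) = e \<cdot> z"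
    using ab(1) LA_obtain by metis
  obtain b' where b': "b' \<in> C" "dm b' = rn b" "rn b' = ob" "b' \<cdot> e = b'" "b \<cdot> b' = e"
    "\<And>z. z \<in> C \<Longrightarrow> dm z = ob \<Longrightarrow> b \<cdot> (b' \<cdot> z) = e \<cdot> z"
    using ab(2) RB_obtain by metis
  define g where "g = a' \<cdot> (v \<cdot> b')"
  have "a \<cdot> (a' \<cdot> v) = a \<cdot> (e \<cdot> (b \<cdot> s))"
    unfolding s(3) using a'(5)[of "b \<cdot> s"] ab s by simp
  also have "\<dots> = a \<cdot> e \<cdot> (b \<cdot> s)"
    using ab(1,2) s(1,2) by (intro assoc[symmetric]) simp_all
  finally have av: "a \<cdot> (a' \<cdot> v) = v" using ab(1) s(3) by simp
  have bv: "v \<cdot> (b' \<cdot> b) = v"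
    unfolding t(3) using b'(1-3) b'(6)[of b] t(1,2) ab(1,2) by simp
  have g: "g \<in> C" "dm g = ob" "rn g = ob" unfolding g_def using a' b' v by simp_all
  have "a \<cdot> (g \<cdot> b) = a \<cdot> (a' \<cdot> v) \<cdot> (b' \<cdot> b)" unfolding g_def using a' b' v ab(1,2) by simp
  hence vg: "v = a \<cdot> (g \<cdot> b)" using av bv by simp
  have "g \<cdot> b \<in> D" using v(1)[unfolded vg]
    by (rule D_factors(2)[rotated 3]) (use g ab in simp_all)
  hence "g \<in> D" by (rule D_factors(1)[rotated 3]) (use g ab in simp_all)
  moreover have "e \<cdot> g = e \<cdot> a' \<cdot> (v \<cdot> b')" unfolding g_def using a'(1-3) b'(1-3) v by simp
  hence "e \<cdot> g = g" unfolding a'(4) g_def .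
  moreover have "g \<cdot> e = g" unfolding g_def using a'(1-3) b'(1-4) v by simp
  ultimately have "g \<in> G" using G_I g by blast
  moreover have "u = a \<cdot> (e \<cdot> b)" using ab by simp
  ultimately show ?thesis using nuI[OF subset_refl ab(1,2)] vg e_in_G by metis
qed

text \<open>Products of a \<open>nu\<close>-pair that stay in \<open>D\<close> are again
  \<open>nu\<close>-pairs; those that drop into \<open>S\<close> lie in \<open>tau T N\<close>,
  which is why \<open>\<sigma>\<close> has to contain it.\<close>

lemma union_nu_congruence:
  assumes \<sigma>: "\<sigma> \<in> Cong_liftable T S" and N: "N \<lhd> H_group T G" and "tau T N \<subseteq> \<sigma>"
  shows "congruence T (\<sigma> \<union> nu T D N)"
proof (rule congruenceI)
  note l = liftableD[OF \<sigma>] and n = normalD[OF N]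
  have in_tau: "(p, q) \<in> \<sigma>"
    if "p \<in> S" "q \<in> S" "\<And>\<rho>. congruence T \<rho> \<Longrightarrow> nu T D N \<subseteq> \<rho> \<Longrightarrow> (p, q) \<in> \<rho>" for p q
    using that assms(3) by (auto simp: tau_def cong_gen_def Cong_def below_max_def)
  show "\<sigma> \<union> nu T D N \<subseteq> C \<times> C" using l(1) nu_subset_D D_subset by blast
  show "(x, x) \<in> \<sigma> \<union> nu T D N" if "x \<in> C" for x using that l(2) nu_refl n by blast
  show "(y, x) \<in> \<sigma> \<union> nu T D N" if "(x, y) \<in> \<sigma> \<union> nu T D N" for x y
    using that l(3) nu_sym by blast
  show "(x, z) \<in> \<sigma> \<union> nu T D N"
    if "(x, y) \<in> \<sigma> \<union> nu T D N" "(y, z) \<in> \<sigma> \<union> nu T D N" for x y z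
    using that l(1,4) nu_subset_D nu_trans[OF N] by blast
  show par: "parallel T x y" if "(x, y) \<in> \<sigma> \<union> nu T D N" for x y
    using that l(5) nu_parallel n(1) by blast
  show "(t \<cdot> x, t \<cdot> y) \<in> \<sigma> \<union> nu T D N"
    if xy: "(x, y) \<in> \<sigma> \<union> nu T D N" and t: "composable T t x" for x y t
  proof (cases "(x, y) \<in> \<sigma>")
    case False
    hence nu: "(x, y) \<in> nu T D N" using xy by blast
    have t': "composable T t y"
      using t par[OF xy] nu nu_subset_D D_subset by (auto simp: composable_def parallel_def)
    show ?thesis
    \<comment> \<open>It is enough that one product is in \<open>D\<close>: \<open>nu_left\<close>,
      applied to the pair or to its reverse, then covers both. In the other case both products are
      in \<open>S\<close>.\<close>
    proof (cases "t \<cdot> x \<in> D \<or> t \<cdot> y \<in> D")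
      case True
      thus ?thesis using nu_left[OF n(1) nu t] nu_sym[OF nu_left[OF n(1) nu_sym[OF nu] t']] by blast
    next
      case False
      moreover have "t \<cdot> x \<in> C" "t \<cdot> y \<in> C" using t t' by (auto simp: composable_def)
      moreover have "(t \<cdot> x, t \<cdot> y) \<in> \<rho>" if "congruence T \<rho>" "nu T D N \<subseteq> \<rho>" for \<rho>
        using congruence_left[OF that(1)] that(2) nu t by blast
      ultimately have "(t \<cdot> x, t \<cdot> y) \<in> \<sigma>" by (intro in_tau) blast+
      thus ?thesis by blast
    qed
  qed (use l t in blast)
  show "(x \<cdot> t, y \<cdot> t) \<in> \<sigma> \<union> nu T D N"
    if xy: "(x, y) \<in> \<sigma> \<union> nu T D N" and t: "composable T x t" for x y t
  proof (cases "(x, y) \<in> \<sigma>")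
    case False
    hence nu: "(x, y) \<in> nu T D N" using xy by blast
    have t': "composable T y t"
      using t par[OF xy] nu nu_subset_D D_subset by (auto simp: composable_def parallel_def)
    show ?thesis
    proof (cases "x \<cdot> t \<in> D \<or> y \<cdot> t \<in> D")
      case True
      thus ?thesis using nu_right[OF n(1) nu t] nu_sym[OF nu_right[OF n(1) nu_sym[OF nu] t']] by blast
    next
      case False
      moreover have "x \<cdot> t \<in> C" "y \<cdot> t \<in> C" using t t' by (auto simp: composable_def)
      moreover have "(x \<cdot> t, y \<cdot> t) \<in> \<rho>" if "congruence T \<rho>" "nu T D N \<subseteq> \<rho>" for \<rho>
        using congruence_right[OF that(1)] that(2) nu t by blast
      ultimately have "(x \<cdot> t, y \<cdot> t) \<in> \<sigma>" by (intro in_tau) blast+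
      thus ?thesis by blast
    qed
  qed (use l t in blast)
qed

lemma union_nu_subset_rees:
  assumes "\<sigma> \<in> Cong_liftable T S" and "N \<subseteq> G"
  shows "\<sigma> \<union> nu T D N \<subseteq> rees_normal T S D G"
  using liftable_subset[OF assms(1)] liftable_parallel[OF assms(1)] nu_mono[OF assms(2)]
  unfolding rees_normal_def rees_def nabla_def by auto

lemma nu_generated:
  assumes "congruence T \<rho>" and "N \<subseteq> G" and "\<And>x. x \<in> N \<Longrightarrow> (x, e) \<in> \<rho>"
  shows "nu T D N \<subseteq> \<rho>"
proof (rule subrelI)
  fix u v assume "(u, v) \<in> nu T D N"
  then obtain x y a b where "x \<in> N" "y \<in> N" "sandwich T a x b u" "sandwich T a y b v"
    by (auto simp: nu_def)
  moreover from this have "(x, y) \<in> \<rho>"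
    using assms(3) congruence_sym[OF assms(1)] congruence_trans[OF assms(1)] by blast
  ultimately show "(u, v) \<in> \<rho>" using congruence_sandwich[OF assms(1)] by blast
qed

text \<open>\<open>\<sigma>\<close> is the part of \<open>\<rho>\<close> on \<open>S\<close>, and
  \<open>N\<close> is the class of \<open>e\<close> in \<open>G\<close>, normal as the kernel of a
  group congruence. The bound on \<open>\<rho>\<close> excludes pairs crossing from \<open>D\<close>
  to \<open>S\<close> and confines those in \<open>D\<close> to \<open>nu T D G\<close>.\<close>

lemma congruence_decomposition:
  assumes \<rho>: "congruence T \<rho>" and sub: "\<rho> \<subseteq> rees_normal T S D G"
  obtains \<sigma> N where "\<sigma> \<in> Cong_liftable T S" "N \<lhd> H_group T G" "tau T N \<subseteq> \<sigma>" "\<rho> = \<sigma> \<union> nu T D N"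
proof -
  note c = congruenceD[OF \<rho>]
  define N where "N = {x \<in> G. (x, e) \<in> \<rho>}"
  have NG: "N \<subseteq> G" by (auto simp: N_def)
  have Gl: "(g \<cdot> x, g \<cdot> y) \<in> \<rho>" and Gr: "(x \<cdot> g, y \<cdot> g) \<in> \<rho>"
    if "(x, y) \<in> \<rho>" "x \<in> G" "g \<in> G" for x y g
    using that c(6)[of x y g] c(7)[of x y g] by (simp_all add: composable_def)
  have N: "N \<lhd> H_group T G"
    unfolding grp.normal_inv_iff
  proof (intro conjI ballI)
    show "subgroup N (H_group T G)"
    proof (rule grp.subgroupI)
      have "e \<in> N" using c(2)[of e] by (simp add: N_def)
      thus "N \<noteq> {}" by blast
      show "ginv x \<in> N" if "x \<in> N" for x
        using that Gl[of x e "ginv x"] c(3) by (simp add: N_def)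
      show "x \<otimes>\<^bsub>H_group T G\<^esub> y \<in> N" if "x \<in> N" "y \<in> N" for x y
        using that Gl[of y e x] c(4) by (simp add: N_def)
    qed (use NG in simp)
    show "x \<otimes>\<^bsub>H_group T G\<^esub> h \<otimes>\<^bsub>H_group T G\<^esub> ginv x \<in> N"
      if "x \<in> carrier (H_group T G)" "h \<in> N" for x h
    proof -
      have x: "x \<in> G" and h: "h \<in> G" "(h, e) \<in> \<rho>" using that by (simp_all add: N_def)
      have "(x \<cdot> h \<cdot> ginv x, x \<cdot> e \<cdot> ginv x) \<in> \<rho>"
        by (rule Gr[OF Gl[OF h(2,1) x]]) (use x h in simp_all)
      thus ?thesis using x h(1) by (simp add: N_def)
    qed
  qed
  have nu: "nu T D N \<subseteq> \<rho>" using nu_generated[OF \<rho> NG] by (simp add: N_def)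
  have "tau T N \<subseteq> \<rho> \<inter> S \<times> S"
    using cong_gen_least[OF \<rho> nu] by (auto simp: tau_def below_max_def)
  moreover have "\<rho> \<subseteq> \<rho> \<inter> S \<times> S \<union> nu T D N"
  proof (rule subrelI)
    fix u v assume uv: "(u, v) \<in> \<rho>"
    consider "(u, v) \<in> S \<times> S" | "u = v" "u \<in> D" | "(u, v) \<in> nu T D G"
      using uv sub c(1) by (auto simp: rees_normal_def rees_def nabla_def)
    thus "(u, v) \<in> \<rho> \<inter> S \<times> S \<union> nu T D N"
    proof cases
      case 3
      obtain a x y b where *: "a \<in> LA" "b \<in> RB" "x \<in> G" "y \<in> G" "u = a \<cdot> (x \<cdot> b)" "v = a \<cdot> (y \<cdot> b)"
        using nuE[OF 3 subset_refl] .
      obtain a' b' where ab': "a' \<in> C" "b' \<in> C" "rn a' = dm a" "dm b' = rn b"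
        "a' \<cdot> (a \<cdot> (x \<cdot> b)) \<cdot> b' = x" "a' \<cdot> (a \<cdot> (y \<cdot> b)) \<cdot> b' = y"
        using coords_recover[OF *(1,2)] *(3,4) by metis
      have "(a' \<cdot> u, a' \<cdot> v) \<in> \<rho>"
        using c(6)[OF uv, of a'] ab'(1-4) * by (simp add: composable_def)
      hence "(a' \<cdot> u \<cdot> b', a' \<cdot> v \<cdot> b') \<in> \<rho>"
        using c(7)[of "a' \<cdot> u" "a' \<cdot> v" b'] ab'(1-4) * by (simp add: composable_def)
      hence "(x, y) \<in> \<rho>" using ab'(5,6) *(5,6) by simp
      hence "(x \<cdot> ginv y, e) \<in> \<rho>" using Gr[of x y "ginv y"] * by simp
      hence n: "x \<cdot> ginv y \<in> N" "e \<in> N" using * c(2)[of e] by (simp_all add: N_def)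
      \<comment> \<open>With \<open>y \<cdot> b\<close> as new right coordinate,
        \<open>u = a (x (ginv y)) (y b)\<close> and \<open>v = a e (y b)\<close>, so both middle
        factors lie in \<open>N\<close>.\<close>
      have e: "e \<cdot> (y \<cdot> b) = y \<cdot> b" using * assoc[of e y b] by simp
      have "y \<cdot> b \<in> D"
        using coords_D[OF *(1,4,2)] by (rule D_factors(2)[rotated 3]) (use * in simp_all)
      hence "y \<cdot> b \<in> RB" using * e by (intro RB_I) simp_all
      hence "(a \<cdot> (x \<cdot> ginv y \<cdot> (y \<cdot> b)), a \<cdot> (e \<cdot> (y \<cdot> b))) \<in> nu T D N"
        using nuI[OF NG *(1)] n by blast
      moreover have "x \<cdot> ginv y \<cdot> (y \<cdot> b) = x \<cdot> (ginv y \<cdot> y) \<cdot> b"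
        using *(1-4) by (simp del: G_simps(8))
      hence "x \<cdot> ginv y \<cdot> (y \<cdot> b) = x \<cdot> b" using *(3,4) by simp
      ultimately show ?thesis using e *(5,6) by simp
    qed (use uv nu_refl normalD[OF N] in blast)+
  qed
  ultimately show ?thesis
    using that[OF restrict_congruence[OF \<rho>] N] nu by blast
qed

text \<open>A pair of \<open>\<rho>\<close> starting in \<open>D\<close> but outside
  \<open>nu T D G\<close> leaves the \<open>green_H\<close>-class, by \<open>H_class_nu\<close>, and
  would then generate \<open>nabla T\<close>.\<close>

lemma nabla_gen_subset_rees:
  assumes gen: "nabla_gen T" and \<rho>: "congruence T \<rho>" "\<rho> \<noteq> nabla T"
  shows "\<rho> \<subseteq> rees_normal T S D G"
proof (rule subrelI)
  note c = congruenceD[OF \<rho>(1)]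
  have D: "(u, v) \<in> nu T D G" if uv: "(u, v) \<in> \<rho>" "u \<in> D" for u v
  proof (rule ccontr)
    assume "(u, v) \<notin> nu T D G"
    hence "v \<notin> H_class T u" using H_class_nu that by blast
    hence "cong_gen T {(u, v)} = nabla T"
      using gen uv c(1) c(5)[OF uv(1)] unfolding nabla_gen_def by blast
    hence "nabla T \<subseteq> \<rho>" using cong_gen_least[OF \<rho>(1), of "{(u, v)}"] uv by blast
    moreover have "\<rho> \<subseteq> nabla T" using c(1,5) by (auto simp: nabla_def)
    ultimately show False using \<rho>(2) by blast
  qed
  fix u v assume uv: "(u, v) \<in> \<rho>"
  show "(u, v) \<in> rees_normal T S D G"
  proof (cases "u \<in> D \<or> v \<in> D")
    case True
    thus ?thesis using D uv c(3) nu_sym unfolding rees_normal_def by blast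
  next
    case False
    thus ?thesis using uv c(1) c(5)[OF uv] by (auto simp: rees_normal_def rees_def nabla_def)
  qed
qed

text \<open>Identifies the members \<open>\<sigma> \<union> Id_on D\<close> of the third description
  as the case of the trivial subgroup.\<close>

lemma nu_trivial: "nu T D {e} = Id_on D"
proof -
  have "u = v" if "(u, v) \<in> nu T D {e}" for u v
    by (rule nuE[OF that]) auto
  thus ?thesis using nu_refl[of "{e}"] nu_subset_D[of "{e}"] by (fastforce simp: Id_on_iff)
qed

text \<open>An element \<open>n\<close> of \<open>N\<close> other than \<open>e\<close> is
  \<open>green_H\<close>-related to \<open>e\<close>, and \<open>(e, n)\<close> is in
  \<open>nu T D N\<close>. (S3) turns it into a pair on \<open>S\<close> that generates the largest
  congruence of \<open>S\<close>.\<close>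

lemma Sep3_nu:
  assumes "Sep T" and gen: "nabla_gen (psg_restrict T S)"
    and N: "N \<lhd> H_group T G" "N \<noteq> {e}" and \<rho>: "congruence T \<rho>" "nu T D N \<subseteq> \<rho>"
  shows "nabla (psg_restrict T S) \<subseteq> \<rho>"
proof -
  obtain n where n: "n \<in> N" "n \<noteq> e" "n \<in> G" using normalD(1,2)[OF N(1)] N(2) by blast
  have "(e, n) \<in> green_H T"
  proof -
    obtain h where h: "G = H_class T h"
      using group_H by (auto simp: group_H_class_def quotient_def)
    hence "(h, e) \<in> green_H T" "(h, n) \<in> green_H T" using e_in_G n by blast+
    thus ?thesis by (auto simp: green_H_def green_R_def green_L_def)
  qed
  hence "\<exists>(x, y) \<in> cong_gen T {(e, n)}. x \<in> max_J_class (psg_restrict T S) \<and>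
      y \<in> S - H_class (psg_restrict T S) x"
    using assms(1) n G_simps(1)[OF e_in_G] unfolding Sep_def Sep3_def below_max_def Let_def
    by simp
  moreover have "(e, n) \<in> \<rho>"
  proof -
    have "e \<in> LA" "e \<in> RB" by (auto intro!: LA_I RB_I)
    hence "(e \<cdot> (e \<cdot> e), e \<cdot> (n \<cdot> e)) \<in> nu T D N"
      using nuI normalD(1,2)[OF N(1)] n by blast
    thus ?thesis using n \<rho>(2) by auto
  qed
  hence "cong_gen T {(e, n)} \<subseteq> \<rho>" using cong_gen_least[OF \<rho>(1)] by blast
  ultimately show ?thesis using nabla_S_subset[OF gen \<rho>(1)] by blast
qed

end

section \<open>Assembly of the interval and the two full lattices\<close>

theorem theorem3p14:
  fixes T :: "('a, 'o) psg" and D S G :: "'a set"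
  assumes "partial_semigroup T"
    and "Dmax T"
    and "D = max_J_class T"
    and "S = carrier T - D"
    and "S \<noteq> {}"
    and "group_H_class T G"
    and "G \<subseteq> D"
  shows
    "{\<rho> \<in> Cong T. Id_on (carrier T) \<subseteq> \<rho> \<and> \<rho> \<subseteq> rees_normal T S D G} =
       {\<sigma> \<union> nu T D N | \<sigma> N.
          \<sigma> \<in> Cong_liftable T S \<and> N \<lhd> H_group T G \<and> tau T N \<subseteq> \<sigma>} \<and>
     (nabla_gen T \<longrightarrow>
       Cong T =
         {\<sigma> \<union> nu T D N | \<sigma> N.
            \<sigma> \<in> Cong_liftable T S \<and> N \<lhd> H_group T G \<and> tau T N \<subseteq> \<sigma>}
         \<union> {nabla T}) \<and>
     (Sep T \<and> nabla_gen (psg_restrict T S) \<longrightarrow>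
       Cong T =
         {\<sigma> \<union> Id_on D | \<sigma>. \<sigma> \<in> Cong_liftable T S}
         \<union> {rees_normal T S D N | N. N \<lhd> H_group T G}
         \<union> {nabla T})"
    (is "?I = ?U \<and> (_ \<longrightarrow> ?two) \<and> (_ \<longrightarrow> ?three)")
proof -
  interpret group_H_sg T G
    using assms by unfold_locales auto
  have S: "S = carrier T - max_J_class T" using assms by simp
  note [simp] = \<open>D = max_J_class T\<close> S
  have UC: "?U \<subseteq> Cong T"
    using union_nu_congruence by (auto simp: Cong_def)
  have one: "?I = ?U"
  proof
    show "?I \<subseteq> ?U"
    proof
      fix \<rho> assume "\<rho> \<in> ?I"
      hence "congruence T \<rho>" "\<rho> \<subseteq> rees_normal T S D G" by (simp_all add: Cong_def)
      then obtain \<sigma> N where "\<sigma> \<in> Cong_liftable T S" "N \<lhd> H_group T G" "tau T N \<subseteq> \<sigma>"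
          "\<rho> = \<sigma> \<union> nu T D N"
        by (auto elim: congruence_decomposition)
      thus "\<rho> \<in> ?U" by blast
    qed
    show "?U \<subseteq> ?I"
    proof
      fix \<rho> assume \<rho>: "\<rho> \<in> ?U"
      hence "congruence T \<rho>" using UC by (auto simp: Cong_def)
      moreover from this have "Id_on (carrier T) \<subseteq> \<rho>" using congruence_refl by auto
      moreover have "\<rho> \<subseteq> rees_normal T S D G"
        using \<rho> union_nu_subset_rees normal_subset by (auto simp del: Un_subset_iff)
      ultimately show "\<rho> \<in> ?I" by (simp add: Cong_def)
    qed
  qed
  have two: ?two if "nabla_gen T"
  proof
    show "Cong T \<subseteq> ?U \<union> {nabla T}"
    proof
      fix \<rho> assume \<rho>: "\<rho> \<in> Cong T"
      show "\<rho> \<in> ?U \<union> {nabla T}"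
      proof (cases "\<rho> = nabla T")
        case False
        hence "\<rho> \<subseteq> rees_normal T S D G"
          using nabla_gen_subset_rees[OF that] \<rho> by (simp add: Cong_def)
        moreover have "Id_on (carrier T) \<subseteq> \<rho>" using \<rho> congruence_refl by (auto simp: Cong_def)
        ultimately have "\<rho> \<in> ?I" using \<rho> by blast
        thus ?thesis unfolding one by blast
      qed blast
    qed
    show "?U \<union> {nabla T} \<subseteq> Cong T" using UC nabla_congruence by (simp add: Cong_def)
  qed
  \<comment> \<open>Equality on \<open>S\<close> is absorbed by the largest relation there, and
    equality on \<open>D\<close> by \<open>nu T D N\<close>.\<close>
  have rees: "rees_normal T S D N = nabla (psg_restrict T S) \<union> nu T D N"
    if "N \<lhd> H_group T G" for N
    using nu_refl[OF normalD(1,2)[OF that]]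
    by (auto simp: rees_normal_def rees_def nabla_def parallel_def)
  have ?three if "Sep T \<and> nabla_gen (psg_restrict T S)"
  proof
    have sep: "Sep T" and gen: "nabla_gen (psg_restrict T (carrier T - max_J_class T))"
      using that by simp_all
    show "Cong T \<subseteq> {\<sigma> \<union> Id_on D | \<sigma>. \<sigma> \<in> Cong_liftable T S}
         \<union> {rees_normal T S D N | N. N \<lhd> H_group T G} \<union> {nabla T}" (is "_ \<subseteq> ?R")
    proof
      fix \<rho> assume \<rho>: "\<rho> \<in> Cong T"
      then consider "\<rho> = nabla T" | \<sigma> N where "\<sigma> \<in> Cong_liftable T S" "N \<lhd> H_group T G"
          "\<rho> = \<sigma> \<union> nu T D N"
        using two nabla_gen_of_Sep[OF sep gen] by blast
      thus "\<rho> \<in> ?R"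
      proof cases
        case (2 \<sigma> N)
        show ?thesis
        \<comment> \<open>The trivial subgroup gives the members
          \<open>\<sigma> \<union> Id_on D\<close>; any other forces \<open>\<sigma>\<close> to be
          the largest congruence on \<open>S\<close>, giving
          \<open>rees_normal T S D N\<close>.\<close>
        proof (cases "N = {e}")
          case True
          thus ?thesis using 2 nu_trivial by auto
        next
          case False
          have "nabla (psg_restrict T S) \<subseteq> \<rho>"
            using Sep3_nu[OF sep gen 2(2) False] \<rho> 2(3) by (simp add: Cong_def)
          \<comment> \<open>The two relations live on \<open>S\<close> and on \<open>D\<close>, so
            what \<open>\<rho>\<close> contains of the former must come from
            \<open>\<sigma>\<close>.\<close>
          moreover have "nabla (psg_restrict T S) \<inter> nu T D N = {}"
            using nu_subset_D by (auto simp: nabla_def)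
          moreover have "\<sigma> \<subseteq> nabla (psg_restrict T S)"
            using liftable_subset liftable_parallel 2(1) by (fastforce simp: nabla_def)
          ultimately have "\<sigma> = nabla (psg_restrict T S)" using 2(3) by blast
          thus ?thesis using rees[OF 2(2)] 2 by blast
        qed
      qed blast
    qed
    have "\<sigma> \<union> Id_on D \<in> Cong T" if "\<sigma> \<in> Cong_liftable T S" for \<sigma>
    proof -
      have "\<sigma> \<union> Id_on D = \<sigma> \<union> Id_on (carrier T)"
        using liftable_refl that D_subset by (auto simp: Id_on_def)
      thus ?thesis using that by (simp add: Cong_liftable_def)
    qed
    moreover have "rees_normal T S D N \<in> Cong T" if "N \<lhd> H_group T G" for N
    proof -
      \<comment> \<open>This is the side condition of \<open>union_nu_congruence\<close>: whatever
        \<open>nu T D N\<close> generates stays inside the largest congruence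
        \<open>nabla T\<close>.\<close>
      have "tau T N \<subseteq> nabla (psg_restrict T S)"
      proof -
        have "cong_gen T (nu T D N) \<subseteq> nabla T"
          using nu_parallel[OF normalD(1)[OF that]] nu_subset_D[of N] D_subset
          by (intro cong_gen_least nabla_congruence) (fastforce simp: nabla_def)
        thus ?thesis by (auto simp: tau_def below_max_def nabla_def)
      qed
      thus ?thesis unfolding rees[OF that]
        using union_nu_congruence[OF nabla_S_liftable that] by (simp add: Cong_def)
    qed
    ultimately show "?R \<subseteq> Cong T" using nabla_congruence by (auto simp: Cong_def)
  qed
  thus ?thesis using one two by blast
qed

end
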